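(* Let $(p_n,q_n)_{n\ge 0}$ be any sequence of pairs of real numbers with $0\le p_n,q_n\le 1$, and let $\mu$ be the Borel probability measure on $\mathbb K=\{0,1\}^{\mathbb N}$ defined by the non-homogeneous Markov rule described in the context. Then $$\dim_*(\mu)=\dim^*(\mu)=h_*(\mu)\qquad\text{and}\qquad \mathrm{Dim}_*(\mu)=\mathrm{Dim}^*(\mu)=h^*(\mu).$$
   Context: $\mathbb K=\{0,1\}^{\mathbb N}$ is the dyadic Cantor set (limit set of the dyadic tree) with the metric in which the cylinder $I_{\epsilon_1\dots\epsilon_n}=\{x\in\mathbb K: x_1=\epsilon_1,\dots,x_n=\epsilon_n\}$ ($\epsilon_i\in\{0,1\}$) has diameter $2^{-n}$. $\mathcal F_n$ denotes the set of cylinders of generation $n$ ($\mathcal F_0=\{\mathbb K\}$). For $x\in\mathbb K$, $I_n(x)$ is the cylinder of $\mathcal F_n$ containing $x$. The measure $\mu$: $\mu(I_0)=p_0$, $\mu(I_1)=1-p_0$, and for $n\ge1$, every $I=I_{\epsilon_1\dots\epsilon_n}$ and $\epsilon_{n+1}\in\{0,1\}$, writing $IJ=I_{\epsilon_1\dots\epsilon_n\epsilon_{n+1}}$, $$\mu(IJ)=\mu(I)\cdot\begin{cases} p_n\mathbf 1_{\{\epsilon_{n+1}=0\}}+(1-p_n)\mathbf 1_{\{\epsilon_{n+1}=1\}} & \text{if } \epsilon_n=0,\\ q_n\mathbf 1_{\{\epsilon_{n+1}=0\}}+(1-q_n)\mathbf 1_{\{\epsilon_{n+1}=1\}} & \text{if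 } \epsilon_n=1.\end{cases}$$ Entropies (with convention $0\log 0=0$): $h_*(\mu)=\liminf_{n\to\infty}\frac{-1}{n\log 2}\sum_{I\in\mathcal F_n}\mu(I)\log\mu(I)$ and $h^*(\mu)=\limsup_{n\to\infty}\frac{-1}{n\log 2}\sum_{I\in\mathcal F_n}\mu(I)\log\mu(I)$. Dimensions of the measure: $\dim_*(\mu)=\inf\{\dim_{\mathcal H}E: E\subset\mathbb K,\ \mu(E)>0\}$, $\dim^*(\mu)=\inf\{\dim_{\mathcal H}E: E\subset\mathbb K,\ \mu(\mathbb K\setminus E)=0\}$, $\mathrm{Dim}_*(\mu)=\inf\{\dim_{\mathcal P}E: \mu(E)>0\}$, $\mathrm{Dim}^*(\mu)=\inf\{\dim_{\mathcal P}E:\mu(\mathbb K\setminus E)=0\}$, where $\dim_{\mathcal H}$ is Hausdorff dimension and $\dim_{\mathcal P}$ is packing (Tricot) dimension. *)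

theory Defs
  imports "HOL-Probability.Probability"
begin

text \<open>Points of the dyadic Cantor set K = {0,1}^N are functions nat => bool;
  the coordinate x_(i+1) of the paper is x i, and False encodes 0, True encodes 1.\<close>

type_synonym cpt = "nat \<Rightarrow> bool"

text \<open>Ultrametric: two points first differing at (0-based) index k share the
  cylinder of generation k, so their distance is 2^(-k).\<close>
definition cdist :: "cpt \<Rightarrow> cpt \<Rightarrow> real" where
  "cdist x y = (if x = y then 0 else (1/2) ^ (LEAST k. x k \<noteq> y k))"

definition cdiam :: "cpt set \<Rightarrow> real" where
  "cdiam U = (if U = {} then 0 else Sup {cdist x y | x y. x \<in> U \<and> y \<in> U})"

definition ccball :: "cpt \<Rightarrow> real \<Rightarrow> cpt set" where
  "ccball x r = {y. cdist x y \<le> r}"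

definition cyl :: "nat \<Rightarrow> cpt \<Rightarrow> cpt set" where
  "cyl n x = {y. \<forall>i<n. y i = x i}"

definition gen :: "nat \<Rightarrow> cpt set set" where
  "gen n = {cyl n x | x. True}"

definition hausdorff_pre :: "real \<Rightarrow> real \<Rightarrow> cpt set \<Rightarrow> ennreal" where
  "hausdorff_pre s \<delta> E = Inf {(\<Sum>i. ennreal (cdiam (U i) powr s)) | U.
      E \<subseteq> (\<Union>i. U i) \<and> (\<forall>i. cdiam (U i) \<le> \<delta>)}"

definition hausdorff_measure :: "real \<Rightarrow> cpt set \<Rightarrow> ennreal" where
  "hausdorff_measure s E = (SUP \<delta>\<in>{0<..}. hausdorff_pre s \<delta> E)"

definition hdim :: "cpt set \<Rightarrow> ereal" where
  "hdim E = Inf {ereal s | s. 0 \<le> s \<and> hausdorff_measure s E = 0}"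

definition packing_pre :: "real \<Rightarrow> real \<Rightarrow> cpt set \<Rightarrow> ennreal" where
  "packing_pre s \<delta> E = Sup {(\<Sum>(x,r)\<in>P. ennreal ((2*r) powr s)) | P.
      finite P \<and> (\<forall>(x,r)\<in>P. x \<in> E \<and> 0 < r \<and> r \<le> \<delta>) \<and>
      (\<forall>a\<in>P. \<forall>b\<in>P. a \<noteq> b \<longrightarrow> ccball (fst a) (snd a) \<inter> ccball (fst b) (snd b) = {})}"

definition packing_pre0 :: "real \<Rightarrow> cpt set \<Rightarrow> ennreal" where
  "packing_pre0 s E = (INF \<delta>\<in>{0<..}. packing_pre s \<delta> E)"

definition packing_measure :: "real \<Rightarrow> cpt set \<Rightarrow> ennreal" where
  "packing_measure s E = Inf {(\<Sum>i. packing_pre0 s (U i)) | U. E \<subseteq> (\<Union>i. U i)}"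

definition pdim :: "cpt set \<Rightarrow> ereal" where
  "pdim E = Inf {ereal s | s. 0 \<le> s \<and> packing_measure s E = 0}"

definition mfactor :: "(nat \<Rightarrow> real) \<Rightarrow> (nat \<Rightarrow> real) \<Rightarrow> cpt \<Rightarrow> nat \<Rightarrow> real" where
  "mfactor p q x i =
     (if i = 0 then (if \<not> x 0 then p 0 else 1 - p 0)
      else if \<not> x (i - 1) then (if \<not> x i then p i else 1 - p i)
      else (if \<not> x i then q i else 1 - q i))"

definition xlogx :: "real \<Rightarrow> real" where
  "xlogx t = (if t = 0 then 0 else t * ln t)"

definition entropy_n :: "cpt measure \<Rightarrow> nat \<Rightarrow> real" where
  "entropy_n \<mu> n = - (\<Sum>I\<in>gen n. xlogx (measure \<mu> I))"

definition h_lower :: "cpt measure \<Rightarrow> ereal" where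
  "h_lower \<mu> = liminf (\<lambda>n. ereal (entropy_n \<mu> n / (real n * ln 2)))"

definition h_upper :: "cpt measure \<Rightarrow> ereal" where
  "h_upper \<mu> = limsup (\<lambda>n. ereal (entropy_n \<mu> n / (real n * ln 2)))"

definition dim_lower :: "cpt measure \<Rightarrow> ereal" where
  "dim_lower \<mu> = Inf {hdim E | E. E \<in> sets \<mu> \<and> emeasure \<mu> E > 0}"

definition dim_upper :: "cpt measure \<Rightarrow> ereal" where
  "dim_upper \<mu> = Inf {hdim E | E. E \<in> sets \<mu> \<and> emeasure \<mu> (UNIV - E) = 0}"

definition Dim_lower :: "cpt measure \<Rightarrow> ereal" where
  "Dim_lower \<mu> = Inf {pdim E | E. E \<in> sets \<mu> \<and> emeasure \<mu> E > 0}"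

definition Dim_upper :: "cpt measure \<Rightarrow> ereal" where
  "Dim_upper \<mu> = Inf {pdim E | E. E \<in> sets \<mu> \<and> emeasure \<mu> (UNIV - E) = 0}"

end

theory Submission
  imports Defs "HOL-Real_Asymp.Real_Asymp"
begin

text \<open>
  Let \<open>I\<^sub>n(x) = - ln \<mu>(cyl n x)\<close>, whose mean is the entropy \<open>e\<^sub>n\<close> of generation \<open>n\<close>. The claim
  reduces to \<open>(I\<^sub>n - e\<^sub>n) / n \<longlonglongrightarrow> 0\<close> almost surely: the mass distribution principle for Hausdorff
  and packing measures then turns \<open>liminf\<close> and \<open>limsup\<close> of the local dimension into the dimensions.

  For the law of large numbers, let \<open>m\<^sub>n\<close> be the mean of \<open>I\<^sub>n - e\<^sub>n\<close> over the points whose \<open>n\<close>-th letter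
  is 0. One Markov step gives \<open>\<bar>m\<^bsub>n+1\<^esub>\<bar> \<le> \<bar>p\<^sub>n - q\<^sub>n\<bar> \<bar>m\<^sub>n\<bar> + 1\<close>, while the variance grows by at most
  \<open>2 \<bar>m\<^sub>n\<bar> \<bar>H(p\<^sub>n) - H(q\<^sub>n)\<bar> + O(1)\<close> with \<open>H\<close> the binary entropy. The point is that
  \<open>\<bar>H(p) - H(q)\<bar> \<le> 4 sqrt (1 - \<bar>p - q\<bar>)\<close>: a step that transports correlations well carries little entropy.
  By Cauchy--Schwarz the variance of \<open>I\<^sub>n\<close> is \<open>O(n\<^bsup>3/2\<^esup>)\<close>, so the second moments of \<open>(I\<^sub>n - e\<^sub>n) / n\<close> are
  summable along \<open>n = k\<^sup>4\<close>, and monotonicity of \<open>I\<^sub>n\<close> together with \<open>e\<^bsub>n+1\<^esub> \<le> e\<^sub>n + 1\<close> fills the gaps.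
\<close>

section \<open>Cylinders and the ultrametric\<close>

lemma self_mem_cyl [simp]: "x \<in> cyl n x"
  by (simp add: cyl_def)

lemma cyl_0 [simp]: "cyl 0 x = UNIV"
  by (simp add: cyl_def)

lemma upd_mem_cyl: "x(n := b) \<in> cyl n x"
  by (simp add: cyl_def)

lemma INF_cyl: "(\<Inter>n. cyl n x) = {x}"
proof (intro equalityI subsetI)
  fix y assume "y \<in> (\<Inter>n. cyl n x)"
  then have "y \<in> cyl (Suc i) x" for i by blast
  then show "y \<in> {x}" by (auto simp: cyl_def fun_eq_iff)
qed simp

lemma cyl_eqI: "y \<in> cyl n x \<Longrightarrow> cyl n y = cyl n x"
  by (auto simp: cyl_def)

lemma cyl_subset_cylI: "m \<le> n \<Longrightarrow> cyl m x \<inter> cyl n y \<noteq> {} \<Longrightarrow> cyl n y \<subseteq> cyl m x"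
  by (auto simp: cyl_def)

lemma half_power_le_iff: "(1/2 :: real) ^ m \<le> (1/2) ^ n \<longleftrightarrow> n \<le> m"
  by (rule power_decreasing_iff) auto

lemma half_power_powr: "((1/2) ^ n) powr s = 2 powr (- (real n * s))"
proof -
  have "(1/2::real) ^ n = 2 powr (- real n)"
    by (simp add: powr_minus powr_realpow power_divide field_simps)
  then show ?thesis by (simp add: powr_powr)
qed

lemma half_power_le_obtain:
  fixes \<delta> :: real
  assumes "0 < \<delta>"
  obtains N where "(1/2) ^ N \<le> \<delta>"
  using real_arch_pow_inv[OF assms, of "1/2"] by (auto intro: less_imp_le)

lemma cdist_le_half_power_iff: "cdist x y \<le> (1/2) ^ n \<longleftrightarrow> y \<in> cyl n x"
proof (cases "x = y")
  case True
  then show ?thesis by (simp add: cdist_def)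
next
  case False
  define L where "L = (LEAST k. x k \<noteq> y k)"
  obtain k where "x k \<noteq> y k" using False by auto
  then have differ: "x L \<noteq> y L" unfolding L_def by (rule LeastI)
  have agree: "y i = x i" if "i < L" for i
    using not_less_Least[OF that[unfolded L_def]] by simp
  have "cdist x y \<le> (1/2) ^ n \<longleftrightarrow> n \<le> L"
    using False by (simp add: cdist_def L_def half_power_le_iff)
  also have "\<dots> \<longleftrightarrow> y \<in> cyl n x"
  proof
    assume "y \<in> cyl n x"
    then have "\<not> L < n" using differ by (auto simp: cyl_def)
    then show "n \<le> L" by simp
  qed (use agree in \<open>simp add: cyl_def\<close>)
  finally show ?thesis .
qed

lemma cdist_nonneg: "0 \<le> cdist x y"
  by (simp add: cdist_def)

lemma cdist_le_1: "cdist x y \<le> 1"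
  using cdist_le_half_power_iff[of x y 0] by simp

lemma cdist_half_power_cases:
  obtains "cdist x y = 0" | n where "cdist x y = (1/2) ^ n"
  by (cases "x = y") (auto simp: cdist_def)

lemma ccball_half_power: "ccball x ((1/2) ^ n) = cyl n x"
  by (simp add: ccball_def cdist_le_half_power_iff)

lemma ccball_0: "ccball x 0 = {x}"
  by (auto simp: ccball_def cdist_def power_le_zero_eq split: if_splits)

lemma ccball_eq_cyl:
  assumes "0 < r"
  obtains n where "(1/2) ^ n \<le> r" "\<And>x. ccball x r = cyl n x" "r \<le> 1 \<Longrightarrow> r \<le> 2 * (1/2) ^ n"
proof -
  define n where "n = (LEAST n. (1/2) ^ n \<le> r)"
  have le: "(1/2) ^ n \<le> r"
    unfolding n_def using half_power_le_obtain[OF assms] by (metis (mono_tags, lifting) LeastI)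
  have least: "n \<le> m" if "(1/2) ^ m \<le> r" for m
    unfolding n_def using that by (rule Least_le)
  have "cdist x y \<le> r \<longleftrightarrow> cdist x y \<le> (1/2) ^ n" for x y
  proof (cases rule: cdist_half_power_cases[of x y])
    case (2 m)
    then show ?thesis using le least[of m] by (auto simp: half_power_le_iff intro: order_trans[OF _ le])
  qed (use assms in simp)
  then have ball: "ccball x r = cyl n x" for x
    by (simp add: ccball_def cdist_le_half_power_iff)
  have "r \<le> 2 * (1/2) ^ n" if "r \<le> 1"
  proof (cases n)
    case (Suc m)
    then have "\<not> (1/2) ^ m \<le> r" using least[of m] by auto
    then show ?thesis using Suc by simp
  qed (use that in simp)
  with le ball show thesis using that by blast
qed

lemma bdd_above_cdist: "bdd_above {cdist x y | x y. x \<in> U \<and> y \<in> U}"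
  by (rule bdd_aboveI[of _ 1]) (use cdist_le_1 in auto)

lemma subset_ccball_cdiam: "x \<in> U \<Longrightarrow> U \<subseteq> ccball x (cdiam U)"
  unfolding ccball_def cdiam_def by (auto intro!: cSup_upper bdd_above_cdist)

lemma cdiam_nonneg: "0 \<le> cdiam U"
proof (cases "U = {}")
  case False
  then obtain x where "x \<in> U" by auto
  then have "cdist x x \<le> cdiam U" using subset_ccball_cdiam by (auto simp: ccball_def)
  then show ?thesis by (simp add: cdist_def)
qed (simp add: cdiam_def)

lemma cdiam_cyl_le: "cdiam (cyl n x) \<le> (1/2) ^ n"
proof -
  let ?D = "{cdist y z | y z. y \<in> cyl n x \<and> z \<in> cyl n x}"
  have "cyl n x \<noteq> {}" using self_mem_cyl by blast
  then have "cdiam (cyl n x) = Sup ?D" by (simp add: cdiam_def)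
  also have "\<dots> \<le> (1/2) ^ n"
  proof (rule cSup_least)
    show "?D \<noteq> {}" using self_mem_cyl by blast
    show "d \<le> (1/2) ^ n" if "d \<in> ?D" for d
      using that by (clarsimp simp: cdist_le_half_power_iff cyl_eqI)
  qed
  finally show ?thesis .
qed

definition trunc :: "nat \<Rightarrow> cpt \<Rightarrow> cpt" where
  "trunc n x = (\<lambda>i. i < n \<and> x i)"

definition words :: "nat \<Rightarrow> cpt set" where
  "words n = {x. \<forall>i\<ge>n. \<not> x i}"

lemma words_0: "words 0 = {\<lambda>_. False}"
  by (auto simp: words_def)

lemma words_Suc: "words (Suc n) = words n \<union> (\<lambda>x. x(n := True)) ` words n"
proof (intro equalityI subsetI)
  fix x assume x: "x \<in> words (Suc n)"
  show "x \<in> words n \<union> (\<lambda>x. x(n := True)) ` words n"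
  proof (cases "x n")
    case True
    then have "x = (x(n := False))(n := True)" by (simp add: fun_upd_idem)
    moreover have "x(n := False) \<in> words n" using x by (auto simp: words_def)
    ultimately show ?thesis by blast
  next
    case False
    then show ?thesis using x by (auto simp: words_def le_Suc_eq dest: Suc_leI le_neq_implies_less)
  qed
qed (auto simp: words_def)

lemma finite_words: "finite (words n)"
  by (induction n) (auto simp: words_0 words_Suc)

lemma sum_words_Suc:
  "(\<Sum>x\<in>words (Suc n). F x) = (\<Sum>x\<in>words n. F x + F (x(n := True)))"
  for F :: "cpt \<Rightarrow> 'a::comm_monoid_add"
proof -
  have "words n \<inter> (\<lambda>x. x(n := True)) ` words n = {}"
    by (auto simp: words_def)
  moreover have "inj_on (\<lambda>x. x(n := True)) (words n)"
  proof (rule inj_on_inverseI)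
    show "(x(n := True))(n := False) = x" if "x \<in> words n" for x
      using that by (auto simp: words_def fun_upd_idem_iff)
  qed
  ultimately show ?thesis
    unfolding words_Suc
    by (subst sum.union_disjoint) (auto simp: finite_words sum.reindex sum.distrib)
qed

lemma trunc_mem_words: "trunc n x \<in> words n"
  by (simp add: trunc_def words_def)

lemma trunc_mem_cyl: "trunc n x \<in> cyl n x"
  by (simp add: trunc_def cyl_def)

lemma mem_cyl_word_iff:
  assumes "y \<in> words n"
  shows "x \<in> cyl n y \<longleftrightarrow> trunc n x = y"
proof
  assume x: "x \<in> cyl n y"
  show "trunc n x = y"
  proof
    fix i show "trunc n x i = y i"
      using x assms by (cases "i < n") (auto simp: trunc_def words_def cyl_def)
  qed
qed (auto simp: cyl_def trunc_def)

lemma inj_on_cyl_words: "inj_on (cyl n) (words n)"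
  by (metis inj_onI mem_cyl_word_iff self_mem_cyl)

lemma gen_eq_cyl_words: "gen n = cyl n ` words n"
proof -
  have "cyl n x \<in> cyl n ` words n" for x
    using cyl_eqI[OF trunc_mem_cyl, of n x] trunc_mem_words by (metis imageI)
  then show ?thesis by (auto simp: gen_def)
qed

lemma finite_gen: "finite (gen n)"
  by (simp add: gen_eq_cyl_words finite_words)

lemma cyl_mem_gen: "cyl n x \<in> gen n"
  by (auto simp: gen_def)

lemma Union_gen: "\<Union>(gen n) = UNIV"
  using cyl_mem_gen self_mem_cyl by blast

lemma disjoint_gen: "disjoint (gen n)"
  by (auto simp: gen_def pairwise_def disjnt_def dest: cyl_eqI)

lemma countable_cylinders: "C \<subseteq> (\<Union>n. gen n) \<Longrightarrow> countable C"
  by (rule countable_subset) (auto intro: countable_finite finite_gen)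

text \<open>\<open>D\<close> consists of the maximal members of \<open>C\<close>, as cylinders are nested or disjoint.\<close>
lemma disjoint_cylinder_subfamily:
  assumes "C \<subseteq> (\<Union>n. gen n)"
  obtains D where "D \<subseteq> C" "disjoint D" "\<Union>D = \<Union>C"
proof
  define D where "D = {I \<in> C. \<forall>J\<in>C. I \<subseteq> J \<longrightarrow> J = I}"
  show "D \<subseteq> C" by (auto simp: D_def)
  show "disjoint D"
  proof (rule pairwiseI, rule ccontr)
    fix I J assume IJ: "I \<in> D" "J \<in> D" "I \<noteq> J" "\<not> disjnt I J"
    have "I \<in> (\<Union>n. gen n)" "J \<in> (\<Union>n. gen n)"
      using IJ assms by (auto simp: D_def)
    then obtain m x n y where "I = cyl m x" "J = cyl n y"
      by (auto simp: gen_def)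
    then have "I \<subseteq> J \<or> J \<subseteq> I"
      using IJ(4) cyl_subset_cylI[of m n x y] cyl_subset_cylI[of n m y x]
      by (cases "m \<le> n") (auto simp: disjnt_def Int_commute)
    then show False using IJ by (auto simp: D_def)
  qed
  have "x \<in> \<Union>D" if x: "x \<in> I" "I \<in> C" for x I
  proof -
    define n where "n = (LEAST n. cyl n x \<in> C)"
    have eq: "\<exists>m. J = cyl m x" if "J \<in> C" "x \<in> J" for J
      using that assms by (force simp: gen_def dest: cyl_eqI)
    then have n: "cyl n x \<in> C" unfolding n_def using x by (metis LeastI)
    have "J = cyl n x" if J: "J \<in> C" "cyl n x \<subseteq> J" for J
    proof -
      obtain m where m: "J = cyl m x" using eq[of J] J self_mem_cyl[of x n] by blast
      then have "n \<le> m" unfolding n_def using J by (auto intro: Least_le)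
      with m J show ?thesis using cyl_subset_cylI[of n m x x] self_mem_cyl[of x] by blast
    qed
    with n have "cyl n x \<in> D" by (auto simp: D_def)
    then show ?thesis using self_mem_cyl by blast
  qed
  with \<open>D \<subseteq> C\<close> show "\<Union>D = \<Union>C" by blast
qed

definition cylindrical :: "nat \<Rightarrow> (cpt \<Rightarrow> 'a) \<Rightarrow> bool" where
  "cylindrical n F \<longleftrightarrow> (\<forall>x y. y \<in> cyl n x \<longrightarrow> F y = F x)"

lemma cylindricalI: "(\<And>x y. y \<in> cyl n x \<Longrightarrow> F y = F x) \<Longrightarrow> cylindrical n F"
  by (simp add: cylindrical_def)

lemma cylindricalD: "cylindrical n F \<Longrightarrow> y \<in> cyl n x \<Longrightarrow> F y = F x"
  by (simp add: cylindrical_def)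

section \<open>Hausdorff and packing measures\<close>

lemma hausdorff_pre_mono: "E \<subseteq> F \<Longrightarrow> hausdorff_pre s \<delta> E \<le> hausdorff_pre s \<delta> F"
  unfolding hausdorff_pre_def by (rule Inf_superset_mono) blast

lemma hausdorff_pre_antimono_mesh: "\<delta> \<le> \<delta>' \<Longrightarrow> hausdorff_pre s \<delta>' E \<le> hausdorff_pre s \<delta> E"
  unfolding hausdorff_pre_def by (rule Inf_superset_mono) (use order_trans in blast)

lemma hausdorff_pre_le_cover:
  "E \<subseteq> (\<Union>i. U i) \<Longrightarrow> (\<And>i. cdiam (U i) \<le> \<delta>) \<Longrightarrow>
    hausdorff_pre s \<delta> E \<le> (\<Sum>i. ennreal (cdiam (U i) powr s))"
  unfolding hausdorff_pre_def by (intro Inf_lower) blast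

lemma hausdorff_pre_antimono_exponent:
  assumes "\<delta> \<le> 1" "s \<le> t"
  shows "hausdorff_pre t \<delta> E \<le> hausdorff_pre s \<delta> E"
  unfolding hausdorff_pre_def[of s]
proof (rule Inf_greatest, clarify)
  fix U :: "nat \<Rightarrow> cpt set"
  assume U: "E \<subseteq> (\<Union>i. U i)" "\<forall>i. cdiam (U i) \<le> \<delta>"
  then have "hausdorff_pre t \<delta> E \<le> (\<Sum>i. ennreal (cdiam (U i) powr t))"
    by (intro hausdorff_pre_le_cover) auto
  also have "\<dots> \<le> (\<Sum>i. ennreal (cdiam (U i) powr s))"
  proof (intro suminf_le ennreal_leI)
    fix i
    have "cdiam (U i) \<le> 1" using U(2) assms(1) by (blast intro: order_trans)
    then show "cdiam (U i) powr t \<le> cdiam (U i) powr s"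
      using assms(2) cdiam_nonneg by (intro powr_mono')
  qed auto
  finally show "hausdorff_pre t \<delta> E \<le> (\<Sum>i. ennreal (cdiam (U i) powr s))" .
qed

lemma hausdorff_pre_le_nn_integral:
  assumes "countable I" "E \<subseteq> (\<Union>i\<in>I. U i)" "0 \<le> \<delta>" "\<And>i. i \<in> I \<Longrightarrow> cdiam (U i) \<le> \<delta>"
  shows "hausdorff_pre s \<delta> E \<le> (\<integral>\<^sup>+i. ennreal (cdiam (U i) powr s) \<partial>count_space I)"
proof -
  define J where "J = to_nat_on I ` I"
  define V where "V n = (if n \<in> J then U (from_nat_into I n) else {})" for n
  have bij: "bij_betw (to_nat_on I) I J"
    unfolding J_def using inj_on_to_nat_on[OF assms(1)] by (rule inj_on_imp_bij_betw)
  have V_to_nat_on: "V (to_nat_on I i) = U i" if "i \<in> I" for i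
    using that assms(1) by (simp add: V_def J_def)
  have "E \<subseteq> (\<Union>n. V n)"
    using assms(2) V_to_nat_on by blast
  moreover have "cdiam (V n) \<le> \<delta>" for n
    using assms(1,3,4) by (auto simp: V_def J_def cdiam_def[of "{}"])
  ultimately have "hausdorff_pre s \<delta> E \<le> (\<Sum>n. ennreal (cdiam (V n) powr s))"
    by (rule hausdorff_pre_le_cover)
  also have "\<dots> = (\<integral>\<^sup>+n. ennreal (cdiam (V n) powr s) \<partial>count_space UNIV)"
    by (rule nn_integral_count_space_nat[symmetric])
  also have "\<dots> = (\<integral>\<^sup>+n. ennreal (cdiam (V n) powr s) \<partial>count_space J)"
    by (rule nn_integral_count_space_eq) (auto simp: V_def cdiam_def)
  also have "\<dots> = (\<integral>\<^sup>+i. ennreal (cdiam (V (to_nat_on I i)) powr s) \<partial>count_space I)"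
    by (rule nn_integral_bij_count_space[OF bij, symmetric])
  also have "\<dots> = (\<integral>\<^sup>+i. ennreal (cdiam (U i) powr s) \<partial>count_space I)"
    by (rule nn_integral_cong) (simp add: V_to_nat_on)
  finally show ?thesis .
qed

lemma hausdorff_pre_le_suminf_sum:
  assumes "\<And>n. finite (C n)" "E \<subseteq> (\<Union>n. \<Union>(C n))" "0 \<le> \<delta>" "\<And>n I. I \<in> C n \<Longrightarrow> cdiam I \<le> \<delta>"
  shows "hausdorff_pre s \<delta> E \<le> (\<Sum>n. \<Sum>I\<in>C n. ennreal (cdiam I powr s))"
proof -
  let ?f = "\<lambda>I. ennreal (cdiam I powr s)"
  have "hausdorff_pre s \<delta> E \<le> (\<integral>\<^sup>+c. ?f (snd c) \<partial>count_space (Sigma UNIV C))"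
  proof (rule hausdorff_pre_le_nn_integral)
    show "countable (Sigma UNIV C)"
      using assms(1) by (intro countable_SIGMA) (auto intro: countable_finite)
    show "E \<subseteq> (\<Union>c\<in>Sigma UNIV C. snd c)"
    proof
      fix x assume "x \<in> E"
      then obtain n I where "I \<in> C n" "x \<in> I" using assms(2) by blast
      then show "x \<in> (\<Union>c\<in>Sigma UNIV C. snd c)" by (intro UN_I[of "(n, I)"]) auto
    qed
  qed (use assms(3,4) in auto)
  also have "\<dots> = (\<integral>\<^sup>+c. ?f (snd c) * indicator (C (fst c)) (snd c) \<partial>count_space UNIV)"
    by (subst nn_integral_count_space_indicator) (auto intro!: nn_integral_cong split: split_indicator)
  also have "\<dots> = (\<integral>\<^sup>+n. \<integral>\<^sup>+I. ?f I * indicator (C n) I \<partial>count_space UNIV \<partial>count_space UNIV)"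
    by (subst nn_integral_fst_count_space[symmetric]) simp
  also have "\<dots> = (\<integral>\<^sup>+n. (\<Sum>I\<in>C n. ?f I) \<partial>count_space UNIV)"
    by (intro nn_integral_cong, subst nn_integral_count_space_indicator[symmetric])
      (simp_all add: nn_integral_count_space_finite assms(1))
  also have "\<dots> = (\<Sum>n. \<Sum>I\<in>C n. ?f I)"
    by (rule nn_integral_count_space_nat)
  finally show ?thesis .
qed

lemma hausdorff_measure_eq_SUP: "hausdorff_measure s E = (SUP N. hausdorff_pre s ((1/2) ^ N) E)"
  unfolding hausdorff_measure_def
proof (rule SUP_eq)
  show "\<exists>N\<in>UNIV. hausdorff_pre s \<delta> E \<le> hausdorff_pre s ((1/2) ^ N) E" if \<delta>: "\<delta> \<in> {0<..}" for \<delta>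
  proof -
    obtain N where "(1/2) ^ N \<le> \<delta>" using half_power_le_obtain \<delta> by auto
    then show ?thesis using hausdorff_pre_antimono_mesh by blast
  qed
qed (auto intro!: bexI[of _ "(1/2) ^ _"])

lemma hausdorff_measure_mono: "E \<subseteq> F \<Longrightarrow> hausdorff_measure s E \<le> hausdorff_measure s F"
  unfolding hausdorff_measure_def by (intro SUP_mono') (rule hausdorff_pre_mono)

lemma hausdorff_measure_antimono_exponent:
  "s \<le> t \<Longrightarrow> hausdorff_measure t E \<le> hausdorff_measure s E"
  unfolding hausdorff_measure_eq_SUP
  by (intro SUP_mono' hausdorff_pre_antimono_exponent) (auto simp: power_le_one)

lemma hausdorff_measure_eq_0I:
  assumes "\<And>N. hausdorff_pre s ((1/2) ^ N) E \<le> ennreal (b N)" "b \<longlonglongrightarrow> 0"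
  shows "hausdorff_measure s E = 0"
proof -
  have "incseq (\<lambda>N. hausdorff_pre s ((1/2) ^ N) E)"
    by (intro incseq_SucI hausdorff_pre_antimono_mesh) simp
  then have "(\<lambda>N. hausdorff_pre s ((1/2) ^ N) E) \<longlonglongrightarrow> hausdorff_measure s E"
    unfolding hausdorff_measure_eq_SUP by (rule LIMSEQ_SUP)
  moreover have "(\<lambda>N. ennreal (b N)) \<longlonglongrightarrow> 0"
    using tendsto_ennrealI[OF assms(2)] by simp
  ultimately have "hausdorff_measure s E \<le> 0"
    by (rule LIMSEQ_le) (use assms(1) in blast)
  then show ?thesis by simp
qed

lemma Inf_zero_exponents_leI:
  fixes m :: "real \<Rightarrow> ennreal"
  assumes "0 \<le> h" "\<And>t. 0 \<le> t \<Longrightarrow> h < ereal t \<Longrightarrow> m t = 0"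
  shows "Inf {ereal s | s. 0 \<le> s \<and> m s = 0} \<le> h"
proof (rule dense_ge)
  fix z assume "h < z"
  then obtain t where t: "h < ereal t" "ereal t < z" using ereal_dense2 by blast
  have "0 < ereal t" using assms(1) t(1) by (rule le_less_trans)
  then have "Inf {ereal s | s. 0 \<le> s \<and> m s = 0} \<le> ereal t"
    using assms(2) t(1) by (intro Inf_lower) auto
  with t(2) show "Inf {ereal s | s. 0 \<le> s \<and> m s = 0} \<le> z" by simp
qed

lemma le_Inf_zero_exponentsI:
  fixes m :: "real \<Rightarrow> ennreal"
  assumes "\<And>s. 0 \<le> s \<Longrightarrow> ereal s < h \<Longrightarrow> m s \<noteq> 0"
  shows "h \<le> Inf {ereal s | s. 0 \<le> s \<and> m s = 0}"
  by (rule Inf_greatest) (use assms not_le in blast)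

lemma packing_pre_mono_mesh: "\<delta> \<le> \<delta>' \<Longrightarrow> packing_pre s \<delta> E \<le> packing_pre s \<delta>' E"
  unfolding packing_pre_def by (rule Sup_subset_mono) fastforce

lemma sum_le_packing_pre:
  assumes "finite J" "\<And>i. i \<in> J \<Longrightarrow> c i \<in> E" "\<And>i. i \<in> J \<Longrightarrow> 0 < \<rho> i \<and> \<rho> i \<le> \<delta>"
    and disj: "disjoint_family_on (\<lambda>i. ccball (c i) (\<rho> i)) J"
  shows "(\<Sum>i\<in>J. ennreal ((2 * \<rho> i) powr s)) \<le> packing_pre s \<delta> E"
proof -
  define P where "P = (\<lambda>i. (c i, \<rho> i)) ` J"
  have "inj_on (\<lambda>i. (c i, \<rho> i)) J"
  proof (rule inj_onI, rule ccontr)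
    fix i j assume ij: "i \<in> J" "j \<in> J" "(c i, \<rho> i) = (c j, \<rho> j)" "i \<noteq> j"
    then have "c i \<in> ccball (c i) (\<rho> i) \<inter> ccball (c j) (\<rho> j)"
      using assms(3)[of i] by (simp add: ccball_def cdist_def)
    then show False using disjoint_family_onD[OF disj ij(1,2,4)] by blast
  qed
  then have "(\<Sum>i\<in>J. ennreal ((2 * \<rho> i) powr s)) = (\<Sum>(x, r)\<in>P. ennreal ((2 * r) powr s))"
    by (simp add: P_def sum.reindex)
  also have "\<dots> \<le> packing_pre s \<delta> E"
    unfolding packing_pre_def
  proof (intro Sup_upper CollectI exI[of _ P] conjI)
    show "finite P" "\<forall>(x, r)\<in>P. x \<in> E \<and> 0 < r \<and> r \<le> \<delta>"
      using assms(1-3) by (auto simp: P_def)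
    show "\<forall>a\<in>P. \<forall>b\<in>P. a \<noteq> b \<longrightarrow> ccball (fst a) (snd a) \<inter> ccball (fst b) (snd b) = {}"
    proof (intro ballI impI)
      fix a b assume "a \<in> P" "b \<in> P" "a \<noteq> b"
      then obtain i j where "i \<in> J" "j \<in> J" "i \<noteq> j" "a = (c i, \<rho> i)" "b = (c j, \<rho> j)"
        by (auto simp: P_def)
      then show "ccball (fst a) (snd a) \<inter> ccball (fst b) (snd b) = {}"
        using disjoint_family_onD[OF disj] by simp
    qed
  qed simp
  finally show ?thesis .
qed

lemma packing_pre0_eq_INF: "packing_pre0 s E = (INF N. packing_pre s ((1/2) ^ N) E)"
  unfolding packing_pre0_def
proof (rule INF_eq)
  show "\<exists>N\<in>UNIV. packing_pre s ((1/2) ^ N) E \<le> packing_pre s \<delta> E" if \<delta>: "\<delta> \<in> {0<..}" for \<delta>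
  proof -
    obtain N where "(1/2) ^ N \<le> \<delta>" using half_power_le_obtain \<delta> by auto
    then show ?thesis using packing_pre_mono_mesh by blast
  qed
qed (auto intro!: bexI[of _ "(1/2) ^ _"])

lemma packing_pre0_eq_0I:
  assumes "\<And>K. N \<le> K \<Longrightarrow> packing_pre s ((1/2) ^ K) E \<le> ennreal (b K)" "b \<longlonglongrightarrow> 0"
  shows "packing_pre0 s E = 0"
proof -
  have "packing_pre0 s E \<le> ennreal (b K)" if "N \<le> K" for K
    unfolding packing_pre0_eq_INF using assms(1)[OF that] by (rule INF_lower2[OF UNIV_I])
  moreover have "(\<lambda>K. ennreal (b K)) \<longlonglongrightarrow> 0"
    using tendsto_ennrealI[OF assms(2)] by simp
  ultimately have "packing_pre0 s E \<le> 0"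
    by (intro LIMSEQ_le_const[of _ 0]) auto
  then show ?thesis by simp
qed

section \<open>Cylinder masses bound Hausdorff and packing measures\<close>

lemma emeasure_Union_le_finite_subfamilies:
  assumes "countable C" "C \<subseteq> sets M"
    and le: "\<And>F. finite F \<Longrightarrow> F \<subseteq> C \<Longrightarrow> emeasure M (\<Union>F) \<le> b"
  shows "emeasure M (\<Union>C) \<le> b"
proof (cases "C = {}")
  case False
  define F where "F i = from_nat_into C ` {..i}" for i
  have F: "finite (F i)" "F i \<subseteq> C" for i
    using from_nat_into[OF False] by (auto simp: F_def)
  have "(\<Union>i. F i) = range (from_nat_into C)" by (auto simp: F_def)
  also have "\<dots> = C" using False assms(1) by (simp add: range_from_nat_into)
  finally have "\<Union>C = (\<Union>i. \<Union>(F i))" by auto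
  moreover have "incseq (\<lambda>i. \<Union>(F i))"
    by (intro incseq_SucI Union_mono) (auto simp: F_def atMost_Suc)
  moreover have "range (\<lambda>i. \<Union>(F i)) \<subseteq> sets M"
    using F assms(2) by (auto intro!: sets.finite_Union)
  ultimately have "emeasure M (\<Union>C) = (SUP i. emeasure M (\<Union>(F i)))"
    by (simp add: SUP_emeasure_incseq)
  also have "\<dots> \<le> b"
    using le F by (intro SUP_least) auto
  finally show ?thesis .
qed simp

lemma emeasure_le_suminf_cover:
  assumes "E \<subseteq> (\<Union>i. U i)"
    and "\<And>i. \<exists>B\<in>sets M. U i \<inter> E \<subseteq> B \<and> emeasure M B \<le> b i"
  shows "emeasure M E \<le> (\<Sum>i. b i)"
proof -
  have "\<forall>i. \<exists>B. B \<in> sets M \<and> U i \<inter> E \<subseteq> B \<and> emeasure M B \<le> b i"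
    using assms(2) by blast
  then obtain B where B: "\<And>i. B i \<in> sets M" "\<And>i. U i \<inter> E \<subseteq> B i" "\<And>i. emeasure M (B i) \<le> b i"
    by metis
  have "E \<subseteq> (\<Union>i. U i \<inter> E)" using assms(1) by blast
  also have "\<dots> \<subseteq> (\<Union>i. B i)" using B(2) by (intro UN_mono) auto
  finally have "emeasure M E \<le> emeasure M (\<Union>i. B i)"
    using B(1) by (intro emeasure_mono) auto
  also have "\<dots> \<le> (\<Sum>i. emeasure M (B i))"
    using B(1) by (intro emeasure_subadditive_countably) auto
  also have "\<dots> \<le> (\<Sum>i. b i)"
    using B(3) by (intro suminf_le) auto
  finally show ?thesis .
qed

lemma two_powr_neg_mult_tendsto_0: "0 < a \<Longrightarrow> (\<lambda>n. 2 powr (- (real n * a))) \<longlonglongrightarrow> 0"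
  by real_asymp

lemma less_LimsupD:
  fixes f :: "_ \<Rightarrow> 'a :: complete_linorder"
  shows "y < Limsup F f \<Longrightarrow> \<exists>\<^sub>F x in F. y < f x"
  using Limsup_bounded[of f y F] by (auto simp: frequently_def not_less)

lemma Liminf_lessD:
  fixes f :: "_ \<Rightarrow> 'a :: complete_linorder"
  shows "Liminf F f < y \<Longrightarrow> \<exists>\<^sub>F x in F. f x < y"
  using Liminf_bounded[of y f F] by (auto simp: frequently_def not_less)

locale cantor_measure = finite_measure M for M :: "cpt measure" +
  assumes space_UNIV [simp]: "space M = UNIV"
    and cyl_in_sets [measurable, simp]: "cyl n x \<in> sets M"
begin

lemma gen_subset_sets: "gen n \<subseteq> sets M"
  by (auto simp: gen_def)

lemma cylindrical_measurable:
  assumes "cylindrical n F" "range F \<subseteq> space N"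
  shows "F \<in> M \<rightarrow>\<^sub>M N"
proof (rule measurableI)
  fix A
  have "F -` A = \<Union>{I \<in> gen n. I \<subseteq> F -` A}"
  proof (intro equalityI subsetI)
    fix x assume "x \<in> F -` A"
    then have "cyl n x \<subseteq> F -` A" using cylindricalD[OF assms(1)] by auto
    then show "x \<in> \<Union>{I \<in> gen n. I \<subseteq> F -` A}" using cyl_mem_gen self_mem_cyl by blast
  qed auto
  also have "\<dots> \<in> sets M"
    using finite_gen gen_subset_sets by (intro sets.finite_Union) auto
  finally show "F -` A \<inter> space M \<in> sets M" by simp
qed (use assms(2) in auto)

lemma sum_measure_gen: "(\<Sum>I\<in>gen n. measure M I) = measure M UNIV"
proof -
  have "(\<Sum>I\<in>gen n. measure M I) = measure M (\<Union>(gen n))"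
    using finite_gen disjoint_gen gen_subset_sets
    by (intro measure_Union'[symmetric]) (auto simp: fmeasurable_eq_sets)
  then show ?thesis by (simp add: Union_gen)
qed

lemma AE_measure_cyl_pos: "AE x in M. \<forall>n. 0 < measure M (cyl n x)"
proof -
  have "AE x in M. 0 < measure M (cyl n x)" for n
  proof (rule AE_I')
    define Z where "Z = {I \<in> gen n. measure M I = 0}"
    have "(\<Union>I\<in>Z. I) \<in> null_sets M"
    proof (rule null_sets_UN')
      show "countable Z" using finite_gen by (simp add: Z_def countable_finite)
      show "I \<in> null_sets M" if "I \<in> Z" for I
        using that gen_subset_sets by (intro null_setsI) (auto simp: Z_def emeasure_eq_measure)
    qed
    then show "\<Union>Z \<in> null_sets M" by simp
    show "{x \<in> space M. \<not> 0 < measure M (cyl n x)} \<subseteq> \<Union>Z"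
    proof
      fix x assume "x \<in> {x \<in> space M. \<not> 0 < measure M (cyl n x)}"
      then have "cyl n x \<in> Z" using cyl_mem_gen by (simp add: Z_def not_less measure_le_0_iff)
      then show "x \<in> \<Union>Z" using self_mem_cyl by blast
    qed
  qed
  then show ?thesis by (simp add: AE_all_countable)
qed

lemma ccball_in_sets [measurable, simp]: "ccball x r \<in> sets M"
proof (cases r "0 :: real" rule: linorder_cases)
  case less
  then have "\<not> cdist x y \<le> r" for y using cdist_nonneg[of x y] by linarith
  then have "ccball x r = {}" by (simp add: ccball_def)
  then show ?thesis by simp
next
  case equal
  then show ?thesis by (simp add: ccball_0 flip: INF_cyl)
next
  case greater
  then show ?thesis by (metis ccball_eq_cyl cyl_in_sets)
qed

definition light :: "real \<Rightarrow> nat \<Rightarrow> cpt \<Rightarrow> bool" where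
  "light s n x \<longleftrightarrow> measure M (cyl n x) \<le> 2 powr (- (real n * s))"

definition heavy :: "real \<Rightarrow> nat \<Rightarrow> cpt \<Rightarrow> bool" where
  "heavy s n x \<longleftrightarrow> 2 powr (- (real n * s)) \<le> measure M (cyl n x)"

lemma light_antimono: "light t n x \<Longrightarrow> s \<le> t \<Longrightarrow> light s n x"
  unfolding light_def by (erule order_trans) (simp add: mult_left_mono)

lemma heavy_mono: "heavy s n x \<Longrightarrow> s \<le> t \<Longrightarrow> heavy t n x"
  unfolding heavy_def by (erule order_trans[rotated]) (simp add: mult_left_mono)

lemma light_measurable [measurable]: "Measurable.pred M (light s n)"
  by (rule cylindrical_measurable[of n]) (auto intro!: cylindricalI simp: light_def dest: cyl_eqI)

lemma measure_ccball_le: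
  assumes "0 < t" and light: "\<forall>n\<ge>N. light t n x" and r: "0 \<le> r" "r \<le> (1/2) ^ N"
  shows "measure M (ccball x r) \<le> r powr t"
proof (cases "r = 0")
  case True
  have "measure M (ccball x 0) \<le> 2 powr (- (real n * t))" if "N \<le> n" for n
  proof -
    have "measure M (ccball x 0) \<le> measure M (cyl n x)"
      by (intro finite_measure_mono) (simp_all add: ccball_0)
    also have "\<dots> \<le> 2 powr (- (real n * t))"
      using light that by (simp add: light_def)
    finally show ?thesis .
  qed
  moreover have "(\<lambda>n. 2 powr (- (real n * t))) \<longlonglongrightarrow> 0"
    using assms(1) by (rule two_powr_neg_mult_tendsto_0)
  ultimately have "measure M (ccball x 0) \<le> 0"
    by (intro LIMSEQ_le_const[of _ 0]) auto
  then show ?thesis using True by simp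
next
  case False
  with r obtain n where n: "(1/2) ^ n \<le> r" "ccball x r = cyl n x"
    using ccball_eq_cyl[of r] by (metis less_eq_real_def)
  have "(1/2::real) ^ n \<le> (1/2) ^ N" using n(1) r(2) by (rule order_trans)
  then have "N \<le> n" by (simp only: half_power_le_iff)
  then have "measure M (ccball x r) \<le> ((1/2) ^ n) powr t"
    using light unfolding n(2) half_power_powr by (simp add: light_def)
  also have "\<dots> \<le> r powr t"
    using n(1) assms(1) by (intro powr_mono2) auto
  finally show ?thesis .
qed

lemma emeasure_le_hausdorff_pre:
  assumes "0 < t" "\<And>x n. x \<in> E \<Longrightarrow> N \<le> n \<Longrightarrow> light t n x"
  shows "emeasure M E \<le> hausdorff_pre t ((1/2) ^ N) E"
  unfolding hausdorff_pre_def
proof (rule Inf_greatest, clarify)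
  fix U :: "nat \<Rightarrow> cpt set"
  assume cover: "E \<subseteq> (\<Union>i. U i)" and diam: "\<forall>i. cdiam (U i) \<le> (1/2) ^ N"
  have "\<exists>B\<in>sets M. U i \<inter> E \<subseteq> B \<and> emeasure M B \<le> ennreal (cdiam (U i) powr t)" for i
  proof (cases "U i \<inter> E = {}")
    case True
    then show ?thesis by (intro bexI[of _ "{}"]) auto
  next
    case False
    then obtain x where x: "x \<in> U i" "x \<in> E" by auto
    show ?thesis
    proof (intro bexI[of _ "ccball x (cdiam (U i))"] conjI)
      show "U i \<inter> E \<subseteq> ccball x (cdiam (U i))"
        using subset_ccball_cdiam[OF x(1)] by blast
      show "emeasure M (ccball x (cdiam (U i))) \<le> ennreal (cdiam (U i) powr t)"
        using assms x(2) diam cdiam_nonneg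
        by (auto simp: emeasure_eq_measure intro!: ennreal_leI measure_ccball_le)
    qed simp
  qed
  with cover show "emeasure M E \<le> (\<Sum>i. ennreal (cdiam (U i) powr t))"
    by (rule emeasure_le_suminf_cover)
qed

lemma emeasure_le_hausdorff_measure:
  assumes E: "E \<in> sets M" and "0 < t"
    and ae: "AE x in M. \<forall>\<^sub>F n in sequentially. light t n x"
  shows "emeasure M E \<le> hausdorff_measure t E"
proof -
  define A where "A N = {x \<in> space M. x \<in> E \<and> (\<forall>n\<ge>N. light t n x)}" for N
  have A [measurable]: "A N \<in> sets M" for N
    unfolding A_def using E by measurable
  have "emeasure M E \<le> emeasure M (\<Union>N. A N)"
  proof (rule emeasure_mono_AE)
    show "AE x in M. x \<in> E \<longrightarrow> x \<in> (\<Union>N. A N)"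
      using ae by eventually_elim (auto simp: A_def eventually_sequentially)
  qed (intro sets.countable_UN', auto simp: A)
  also have "\<dots> = (SUP N. emeasure M (A N))"
  proof (rule SUP_emeasure_incseq[symmetric])
    show "incseq A" by (intro incseq_SucI) (auto simp: A_def)
  qed (use A in auto)
  also have "\<dots> \<le> hausdorff_measure t E"
  proof (rule SUP_least)
    fix N
    have "emeasure M (A N) \<le> hausdorff_pre t ((1/2) ^ N) (A N)"
      using assms(2) by (rule emeasure_le_hausdorff_pre) (simp add: A_def)
    also have "\<dots> \<le> hausdorff_measure t (A N)"
      unfolding hausdorff_measure_def by (rule SUP_upper) simp
    also have "\<dots> \<le> hausdorff_measure t E"
      by (rule hausdorff_measure_mono) (auto simp: A_def)
    finally show "emeasure M (A N) \<le> hausdorff_measure t E" .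
  qed
  finally show ?thesis .
qed

lemma sum_cdiam_heavy_le:
  assumes "0 \<le> t"
  shows "(\<Sum>I\<in>cyl n ` {x. heavy s n x}. ennreal (cdiam I powr t))
    \<le> ennreal (measure M UNIV * (2 powr (s - t)) ^ n)"
proof -
  let ?C = "cyl n ` {x. heavy s n x}"
  have C: "?C \<subseteq> gen n" "\<And>I. I \<in> ?C \<Longrightarrow> 2 powr (- (real n * s)) \<le> measure M I"
    by (auto simp: gen_def heavy_def)
  have "cdiam I powr t \<le> measure M I * (2 powr (s - t)) ^ n" if I: "I \<in> ?C" for I
  proof -
    have "cdiam I powr t \<le> ((1/2) ^ n) powr t"
      using I assms by (auto intro!: powr_mono2 cdiam_nonneg cdiam_cyl_le)
    also have "\<dots> = 2 powr (- (real n * s)) * (2 powr (s - t)) ^ n"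
      unfolding half_power_powr
      by (simp add: powr_realpow[symmetric] powr_powr powr_add[symmetric] algebra_simps)
    also have "\<dots> \<le> measure M I * (2 powr (s - t)) ^ n"
      using C(2)[OF I] by (intro mult_right_mono) auto
    finally show ?thesis .
  qed
  then have "(\<Sum>I\<in>?C. cdiam I powr t) \<le> (\<Sum>I\<in>?C. measure M I) * (2 powr (s - t)) ^ n"
    unfolding sum_distrib_right by (rule sum_mono)
  also have "(\<Sum>I\<in>?C. measure M I) \<le> (\<Sum>I\<in>gen n. measure M I)"
    using C(1) by (intro sum_mono2 finite_gen) auto
  finally have "(\<Sum>I\<in>?C. cdiam I powr t) \<le> measure M UNIV * (2 powr (s - t)) ^ n"
    by (simp add: sum_measure_gen)
  then show ?thesis by (subst sum_ennreal) (auto intro: ennreal_leI)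
qed

lemma hausdorff_pre_heavy_le:
  assumes "0 \<le> t" "s < t" "\<And>x. x \<in> E \<Longrightarrow> \<exists>n\<ge>N. heavy s n x"
  shows "hausdorff_pre t ((1/2) ^ N) E
    \<le> ennreal (measure M UNIV * (2 powr (s - t)) ^ N / (1 - 2 powr (s - t)))"
proof -
  define r :: real where "r = 2 powr (s - t)"
  have r: "0 < r" "r < 1" using assms(2) powr_less_mono[of "s - t" 0 2] by (auto simp: r_def)
  define C where "C n = cyl n ` {x. heavy s n x}" for n
  have "hausdorff_pre t ((1/2) ^ N) E \<le> (\<Sum>n. \<Sum>I\<in>C (n + N). ennreal (cdiam I powr t))"
  proof (rule hausdorff_pre_le_suminf_sum)
    show "finite (C (n + N))" for n
      by (rule finite_subset[OF _ finite_gen]) (auto simp: C_def gen_def)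
    show "E \<subseteq> (\<Union>n. \<Union>(C (n + N)))"
    proof
      fix x assume "x \<in> E"
      then obtain n where "N \<le> n" "heavy s n x" using assms(3) by blast
      then have "cyl n x \<in> C (n - N + N)" by (simp add: C_def)
      then show "x \<in> (\<Union>n. \<Union>(C (n + N)))" using self_mem_cyl by blast
    qed
    show "cdiam I \<le> (1/2) ^ N" if I: "I \<in> C (n + N)" for n I
    proof -
      have "cdiam I \<le> (1/2) ^ (n + N)" using I cdiam_cyl_le by (auto simp: C_def)
      also have "\<dots> \<le> (1/2) ^ N" by (intro power_decreasing) auto
      finally show ?thesis .
    qed
  qed simp
  also have "\<dots> \<le> (\<Sum>n. ennreal (measure M UNIV * r ^ (n + N)))"
    using sum_cdiam_heavy_le[OF assms(1)] by (intro suminf_le) (auto simp: C_def r_def)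
  also have "\<dots> = ennreal (measure M UNIV * r ^ N / (1 - r))"
  proof (rule suminf_ennreal_eq)
    show "(\<lambda>n. measure M UNIV * r ^ (n + N)) sums (measure M UNIV * r ^ N / (1 - r))"
      using sums_mult[OF geometric_sums[of r], of "measure M UNIV * r ^ N"] r
      by (simp add: power_add mult_ac)
  qed (use r in simp)
  finally show ?thesis by (simp add: r_def)
qed

lemma hausdorff_measure_eq_0:
  assumes "0 \<le> t" "s < t" "\<And>x. x \<in> E \<Longrightarrow> \<exists>\<^sub>F n in sequentially. heavy s n x"
  shows "hausdorff_measure t E = 0"
proof (rule hausdorff_measure_eq_0I)
  show "hausdorff_pre t ((1/2) ^ N) E
    \<le> ennreal (measure M UNIV * (2 powr (s - t)) ^ N / (1 - 2 powr (s - t)))" for N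
    using assms by (intro hausdorff_pre_heavy_le) (auto simp: frequently_sequentially)
  have "2 powr (s - t) < (1::real)"
    using assms(2) powr_less_mono[of "s - t" 0 2] by simp
  then show "(\<lambda>N. measure M UNIV * (2 powr (s - t)) ^ N / (1 - 2 powr (s - t))) \<longlonglongrightarrow> 0"
    by (intro tendsto_divide_zero tendsto_mult_right_zero LIMSEQ_realpow_zero) auto
qed

lemma powr_le_measure_ccball:
  assumes "0 \<le> t" "s \<le> t" and heavy: "\<forall>n\<ge>N. heavy s n x" and \<rho>: "0 < \<rho>" "\<rho> \<le> (1/2) ^ N"
  shows "(2 * \<rho>) powr t \<le> 4 powr t * 2 powr (- (real N * (t - s))) * measure M (ccball x \<rho>)"
proof -
  obtain n where n: "(1/2) ^ n \<le> \<rho>" "ccball x \<rho> = cyl n x" "\<rho> \<le> 1 \<Longrightarrow> \<rho> \<le> 2 * (1/2) ^ n"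
    using ccball_eq_cyl[OF \<rho>(1)] by metis
  have "(1/2::real) ^ n \<le> (1/2) ^ N" using n(1) \<rho>(2) by (rule order_trans)
  then have "N \<le> n" by (simp only: half_power_le_iff)
  have "(1/2::real) ^ N \<le> 1" by (simp add: power_le_one)
  then have "\<rho> \<le> 2 * (1/2) ^ n" using n(3) \<rho>(2) by simp
  then have "(2 * \<rho>) powr t \<le> (4 * (1/2) ^ n) powr t"
    using \<rho> assms(1) by (intro powr_mono2) auto
  also have "\<dots> = 4 powr t * (2 powr (- (real n * (t - s))) * 2 powr (- (real n * s)))"
    by (subst powr_mult) (simp_all add: half_power_powr powr_add[symmetric] algebra_simps del: power_one_over)
  also have "\<dots> \<le> 4 powr t * (2 powr (- (real N * (t - s))) * measure M (cyl n x))"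
    using heavy \<open>N \<le> n\<close> assms(2) by (intro mult_left_mono mult_mono) (auto simp: heavy_def mult_right_mono)
  finally show ?thesis by (simp add: n(2) mult.assoc)
qed

lemma packing_pre_heavy_le:
  assumes "0 \<le> t" "s \<le> t" "\<And>x n. x \<in> A \<Longrightarrow> N \<le> n \<Longrightarrow> heavy s n x"
  shows "packing_pre t ((1/2) ^ N) A \<le> ennreal (4 powr t * 2 powr (- (real N * (t - s))) * measure M UNIV)"
  unfolding packing_pre_def
proof (rule Sup_least, clarify)
  fix P :: "(cpt \<times> real) set"
  assume P: "finite P" "\<forall>(x, \<rho>)\<in>P. x \<in> A \<and> 0 < \<rho> \<and> \<rho> \<le> (1/2) ^ N"
    and disj: "\<forall>a\<in>P. \<forall>b\<in>P. a \<noteq> b \<longrightarrow> ccball (fst a) (snd a) \<inter> ccball (fst b) (snd b) = {}"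
  let ?ball = "\<lambda>c. ccball (fst c) (snd c)"
  let ?b = "4 powr t * 2 powr (- (real N * (t - s)))"
  have "(\<Sum>c\<in>P. (2 * snd c) powr t) \<le> (\<Sum>c\<in>P. ?b * measure M (?ball c))"
    using P(2) assms by (intro sum_mono powr_le_measure_ccball) auto
  also have "\<dots> = ?b * (\<Sum>c\<in>P. measure M (?ball c))"
    by (simp add: sum_distrib_left)
  also have "(\<Sum>c\<in>P. measure M (?ball c)) = measure M (\<Union>c\<in>P. ?ball c)"
    using P(1) disj by (intro finite_measure_finite_Union[symmetric]) (auto simp: disjoint_family_on_def)
  also have "?b * \<dots> \<le> ?b * measure M UNIV"
    using bounded_measure by (intro mult_left_mono) auto
  finally have "(\<Sum>c\<in>P. (2 * snd c) powr t) \<le> ?b * measure M UNIV" .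
  then show "(\<Sum>(x, \<rho>)\<in>P. ennreal ((2 * \<rho>) powr t)) \<le> ennreal (?b * measure M UNIV)"
    by (simp add: split_beta sum_ennreal ennreal_leI)
qed

lemma packing_measure_eq_0:
  assumes "0 \<le> t" "s < t" "\<And>x. x \<in> E \<Longrightarrow> \<forall>\<^sub>F n in sequentially. heavy s n x"
  shows "packing_measure t E = 0"
proof -
  define A where "A N = {x. \<forall>n\<ge>N. heavy s n x}" for N
  have "packing_pre0 t (A N) = 0" for N
  proof (rule packing_pre0_eq_0I)
    show "packing_pre t ((1/2) ^ K) (A N) \<le> ennreal (4 powr t * 2 powr (- (real K * (t - s))) * measure M UNIV)"
      if "N \<le> K" for K
      using assms that by (intro packing_pre_heavy_le) (auto simp: A_def)
    have "(\<lambda>K. 2 powr (- (real K * (t - s)))) \<longlonglongrightarrow> 0"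
      using assms(2) by (intro two_powr_neg_mult_tendsto_0) simp
    then show "(\<lambda>K. 4 powr t * 2 powr (- (real K * (t - s))) * measure M UNIV) \<longlonglongrightarrow> 0"
      by (intro tendsto_mult_left_zero tendsto_mult_right_zero)
  qed
  moreover have "E \<subseteq> (\<Union>N. A N)"
    using assms(3) by (auto simp: A_def eventually_sequentially)
  then have "packing_measure t E \<le> (\<Sum>N. packing_pre0 t (A N))"
    unfolding packing_measure_def by (intro Inf_lower) blast
  ultimately show ?thesis by simp
qed

lemma emeasure_finite_Union_le_packing_pre:
  assumes "0 \<le> s" "finite F" "disjoint F"
    and "\<And>I. I \<in> F \<Longrightarrow> \<exists>x\<in>U. \<exists>n\<ge>N. I = cyl n x \<and> light s n x"
  shows "emeasure M (\<Union>F) \<le> packing_pre s ((1/2) ^ N) U"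
proof -
  have "\<forall>I\<in>F. \<exists>x n. x \<in> U \<and> N \<le> n \<and> I = cyl n x \<and> light s n x"
    using assms(4) by blast
  then obtain c l where I: "\<And>I. I \<in> F \<Longrightarrow> c I \<in> U \<and> N \<le> l I \<and> I = cyl (l I) (c I) \<and> light s (l I) (c I)"
    by metis
  have "I \<in> sets M" if "I \<in> F" for I using I[OF that] cyl_in_sets by metis
  then have "emeasure M (\<Union>F) \<le> (\<Sum>I\<in>F. emeasure M I)"
    using emeasure_subadditive_finite[of F "\<lambda>I. I" M] assms(2) by auto
  also have "\<dots> \<le> (\<Sum>I\<in>F. ennreal ((2 * (1/2) ^ l I) powr s))"
  proof (rule sum_mono)
    fix I assume "I \<in> F"
    then have "measure M I \<le> 2 powr (- (real (l I) * s))" using I by (metis light_def)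
    also have "\<dots> = ((1/2) ^ l I) powr s" by (simp only: half_power_powr)
    also have "\<dots> \<le> (2 * (1/2) ^ l I) powr s"
      using assms(1) by (intro powr_mono2) auto
    finally show "emeasure M I \<le> ennreal ((2 * (1/2) ^ l I) powr s)"
      by (simp add: emeasure_eq_measure ennreal_leI)
  qed
  also have "\<dots> \<le> packing_pre s ((1/2) ^ N) U"
  proof (rule sum_le_packing_pre)
    show "c I \<in> U" "0 < (1/2 :: real) ^ l I \<and> (1/2 :: real) ^ l I \<le> (1/2) ^ N" if "I \<in> F" for I
      using I[OF that] by (simp_all only: half_power_le_iff) simp
    have "ccball (c I) ((1/2) ^ l I) = I" if "I \<in> F" for I
      using I[OF that] by (simp only: ccball_half_power)
    then show "disjoint_family_on (\<lambda>I. ccball (c I) ((1/2) ^ l I)) F"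
      using pairwiseD[OF assms(3)] by (simp add: disjoint_family_on_def disjnt_def)
  qed (use assms(2) in auto)
  finally show ?thesis .
qed

lemma light_cover_le_packing_pre:
  assumes "0 \<le> s" "\<And>x. x \<in> A \<Longrightarrow> \<exists>\<^sub>F n in sequentially. light s n x" "A \<subseteq> U"
  shows "\<exists>B\<in>sets M. A \<subseteq> B \<and> emeasure M B \<le> packing_pre s ((1/2) ^ N) U"
proof -
  define C where "C = {cyl n x | n x. x \<in> A \<and> N \<le> n \<and> light s n x}"
  have C: "C \<subseteq> (\<Union>n. gen n)" by (auto simp: C_def gen_def)
  then obtain D where D: "D \<subseteq> C" "disjoint D" "\<Union>D = \<Union>C"
    by (rule disjoint_cylinder_subfamily)
  have "A \<subseteq> \<Union>D"
    unfolding D(3)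
  proof
    fix x assume "x \<in> A"
    then obtain n where "N \<le> n" "light s n x"
      using assms(2) unfolding frequently_sequentially by meson
    with \<open>x \<in> A\<close> have "cyl n x \<in> C" by (auto simp: C_def)
    then show "x \<in> \<Union>C" using self_mem_cyl by blast
  qed
  moreover have D_sets: "countable D" "D \<subseteq> sets M"
    using D(1) C gen_subset_sets by (auto intro!: countable_cylinders)
  then have "\<Union>D \<in> sets M" by (rule sets.countable_Union)
  moreover have "emeasure M (\<Union>D) \<le> packing_pre s ((1/2) ^ N) U"
    using D_sets
  proof (rule emeasure_Union_le_finite_subfamilies)
    fix F assume F: "finite F" "F \<subseteq> D"
    with D assms(3) show "emeasure M (\<Union>F) \<le> packing_pre s ((1/2) ^ N) U"
      by (intro emeasure_finite_Union_le_packing_pre assms(1) pairwise_subset[OF D(2) F(2)])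
        (auto simp: C_def dest!: subsetD)
  qed
  ultimately show ?thesis by blast
qed

lemma light_cover_le_packing_pre0:
  assumes "0 \<le> s" "\<And>x. x \<in> A \<Longrightarrow> \<exists>\<^sub>F n in sequentially. light s n x" "A \<subseteq> U"
  shows "\<exists>B\<in>sets M. A \<subseteq> B \<and> emeasure M B \<le> packing_pre0 s U"
proof -
  have "\<forall>N. \<exists>B. B \<in> sets M \<and> A \<subseteq> B \<and> emeasure M B \<le> packing_pre s ((1/2) ^ N) U"
    using light_cover_le_packing_pre[OF assms] by blast
  then obtain B where B: "\<And>N. B N \<in> sets M" "\<And>N. A \<subseteq> B N"
    "\<And>N. emeasure M (B N) \<le> packing_pre s ((1/2) ^ N) U"
    by metis
  have "emeasure M (\<Inter>N. B N) \<le> packing_pre s ((1/2) ^ N) U" for N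
    using B(1) by (intro order_trans[OF emeasure_mono B(3)]) auto
  then have "emeasure M (\<Inter>N. B N) \<le> packing_pre0 s U"
    unfolding packing_pre0_eq_INF by (rule INF_greatest)
  with B(1,2) show ?thesis by (intro bexI[of _ "\<Inter>N. B N"]) auto
qed

lemma emeasure_le_packing_measure:
  assumes E: "E \<in> sets M" and "0 \<le> s"
    and ae: "AE x in M. \<exists>\<^sub>F n in sequentially. light s n x"
  shows "emeasure M E \<le> packing_measure s E"
  unfolding packing_measure_def
proof (rule Inf_greatest, clarify)
  fix U :: "nat \<Rightarrow> cpt set"
  assume cover: "E \<subseteq> (\<Union>i. U i)"
  define G where "G = {x \<in> space M. x \<in> E \<and> (\<exists>\<^sub>F n in sequentially. light s n x)}"
  have G: "G \<in> sets M"
    unfolding G_def frequently_sequentially using E by measurable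
  have "emeasure M E \<le> emeasure M G"
  proof (rule emeasure_mono_AE)
    show "AE x in M. x \<in> E \<longrightarrow> x \<in> G"
      using ae by eventually_elim (simp add: G_def)
  qed (rule G)
  also have "\<dots> \<le> (\<Sum>i. packing_pre0 s (U i))"
  proof (rule emeasure_le_suminf_cover)
    show "\<exists>B\<in>sets M. U i \<inter> G \<subseteq> B \<and> emeasure M B \<le> packing_pre0 s (U i)" for i
      using assms(2) by (rule light_cover_le_packing_pre0) (auto simp: G_def)
  qed (use cover in \<open>auto simp: G_def\<close>)
  finally show "emeasure M E \<le> (\<Sum>i. packing_pre0 s (U i))" .
qed

section \<open>Dimensions of a measure from its local exponents\<close>

definition has_local_exponents :: "(nat \<Rightarrow> real) \<Rightarrow> cpt \<Rightarrow> bool" where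
  "has_local_exponents h x \<longleftrightarrow>
     (\<forall>\<epsilon>>0. \<forall>\<^sub>F n in sequentially. heavy (h n + \<epsilon>) n x \<and> light (h n - \<epsilon>) n x)"

lemma has_local_exponents_heavy:
  "has_local_exponents h x \<Longrightarrow> 0 < \<epsilon> \<Longrightarrow> \<forall>\<^sub>F n in sequentially. heavy (h n + \<epsilon>) n x"
  unfolding has_local_exponents_def by (blast intro: eventually_mono)

lemma has_local_exponents_light:
  "has_local_exponents h x \<Longrightarrow> 0 < \<epsilon> \<Longrightarrow> \<forall>\<^sub>F n in sequentially. light (h n - \<epsilon>) n x"
  unfolding has_local_exponents_def by (blast intro: eventually_mono)

lemma eventually_light:
  assumes "has_local_exponents h x" "ereal s < liminf (\<lambda>n. ereal (h n))"
  shows "\<forall>\<^sub>F n in sequentially. light s n x"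
proof -
  obtain t where t: "s < t" "ereal t < liminf (\<lambda>n. ereal (h n))"
    using ereal_dense2[OF assms(2)] by auto
  have "\<forall>\<^sub>F n in sequentially. light (h n - (t - s)) n x"
    using assms(1) t(1) by (intro has_local_exponents_light) auto
  then show ?thesis
    using less_LiminfD[OF t(2)] by eventually_elim (auto elim: light_antimono)
qed

lemma frequently_light:
  assumes "has_local_exponents h x" "ereal s < limsup (\<lambda>n. ereal (h n))"
  shows "\<exists>\<^sub>F n in sequentially. light s n x"
proof -
  obtain t where t: "s < t" "ereal t < limsup (\<lambda>n. ereal (h n))"
    using ereal_dense2[OF assms(2)] by auto
  have "\<exists>\<^sub>F n in sequentially. t < h n"
    using less_LimsupD[OF t(2)] by simp
  moreover have "\<forall>\<^sub>F n in sequentially. light (h n - (t - s)) n x"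
    using assms(1) t(1) by (intro has_local_exponents_light) auto
  ultimately have "\<exists>\<^sub>F n in sequentially. light (h n - (t - s)) n x \<and> t < h n"
    by (rule frequently_eventually_conj)
  then show ?thesis by (rule frequently_elim1) (auto elim: light_antimono)
qed

lemma frequently_heavy:
  assumes "has_local_exponents h x" "liminf (\<lambda>n. ereal (h n)) < ereal s"
  shows "\<exists>\<^sub>F n in sequentially. heavy s n x"
proof -
  obtain t where t: "t < s" "liminf (\<lambda>n. ereal (h n)) < ereal t"
    using ereal_dense2[OF assms(2)] by auto
  have "\<exists>\<^sub>F n in sequentially. h n < t"
    using Liminf_lessD[OF t(2)] by simp
  moreover have "\<forall>\<^sub>F n in sequentially. heavy (h n + (s - t)) n x"
    using assms(1) t(1) by (intro has_local_exponents_heavy) auto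
  ultimately have "\<exists>\<^sub>F n in sequentially. heavy (h n + (s - t)) n x \<and> h n < t"
    by (rule frequently_eventually_conj)
  then show ?thesis by (rule frequently_elim1) (auto elim: heavy_mono)
qed

lemma eventually_heavy:
  assumes "has_local_exponents h x" "limsup (\<lambda>n. ereal (h n)) < ereal s"
  shows "\<forall>\<^sub>F n in sequentially. heavy s n x"
proof -
  obtain t where t: "t < s" "limsup (\<lambda>n. ereal (h n)) < ereal t"
    using ereal_dense2[OF assms(2)] by auto
  have "\<forall>\<^sub>F n in sequentially. heavy (h n + (s - t)) n x"
    using assms(1) t(1) by (intro has_local_exponents_heavy) auto
  then show ?thesis
    using Limsup_lessD[OF t(2)] by eventually_elim (auto elim: heavy_mono)
qed

lemma liminf_le_hdim:
  assumes ae: "AE x in M. has_local_exponents h x"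
    and E: "E \<in> sets M" "0 < emeasure M E"
  shows "liminf (\<lambda>n. ereal (h n)) \<le> hdim E"
  unfolding hdim_def
proof (rule le_Inf_zero_exponentsI)
  fix s :: real assume "0 \<le> s" "ereal s < liminf (\<lambda>n. ereal (h n))"
  then obtain t where t: "ereal s < ereal t" "ereal t < liminf (\<lambda>n. ereal (h n))"
    using ereal_dense2 by blast
  have "AE x in M. \<forall>\<^sub>F n in sequentially. light t n x"
    using ae by eventually_elim (rule eventually_light[OF _ t(2)])
  then have "emeasure M E \<le> hausdorff_measure t E"
    using E(1) \<open>0 \<le> s\<close> t(1) by (intro emeasure_le_hausdorff_measure) auto
  also have "\<dots> \<le> hausdorff_measure s E"
    using t(1) by (intro hausdorff_measure_antimono_exponent) simp
  finally show "hausdorff_measure s E \<noteq> 0" using E(2) by auto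
qed

lemma limsup_le_pdim:
  assumes ae: "AE x in M. has_local_exponents h x"
    and E: "E \<in> sets M" "0 < emeasure M E"
  shows "limsup (\<lambda>n. ereal (h n)) \<le> pdim E"
  unfolding pdim_def
proof (rule le_Inf_zero_exponentsI)
  fix s :: real assume s: "0 \<le> s" "ereal s < limsup (\<lambda>n. ereal (h n))"
  have "AE x in M. \<exists>\<^sub>F n in sequentially. light s n x"
    using ae by eventually_elim (rule frequently_light[OF _ s(2)])
  then have "emeasure M E \<le> packing_measure s E"
    using E(1) s(1) by (intro emeasure_le_packing_measure)
  then show "packing_measure s E \<noteq> 0" using E(2) by auto
qed

lemma hdim_le_liminf:
  assumes "\<And>x. x \<in> E \<Longrightarrow> has_local_exponents h x" "0 \<le> liminf (\<lambda>n. ereal (h n))"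
  shows "hdim E \<le> liminf (\<lambda>n. ereal (h n))"
  unfolding hdim_def using assms(2)
proof (rule Inf_zero_exponents_leI)
  fix t :: real assume "0 \<le> t" "liminf (\<lambda>n. ereal (h n)) < ereal t"
  then obtain s where s: "liminf (\<lambda>n. ereal (h n)) < ereal s" "ereal s < ereal t"
    using ereal_dense2 by blast
  show "hausdorff_measure t E = 0"
    using \<open>0 \<le> t\<close> s(2) frequently_heavy[OF assms(1) s(1)] by (intro hausdorff_measure_eq_0) auto
qed

lemma pdim_le_limsup:
  assumes "\<And>x. x \<in> E \<Longrightarrow> has_local_exponents h x" "0 \<le> limsup (\<lambda>n. ereal (h n))"
  shows "pdim E \<le> limsup (\<lambda>n. ereal (h n))"
  unfolding pdim_def using assms(2)
proof (rule Inf_zero_exponents_leI)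
  fix t :: real assume "0 \<le> t" "limsup (\<lambda>n. ereal (h n)) < ereal t"
  then obtain s where s: "limsup (\<lambda>n. ereal (h n)) < ereal s" "ereal s < ereal t"
    using ereal_dense2 by blast
  show "packing_measure t E = 0"
    using \<open>0 \<le> t\<close> s(2) eventually_heavy[OF assms(1) s(1)] by (intro packing_measure_eq_0) auto
qed

lemma AE_obtain_full_set:
  assumes "AE x in M. P x"
  obtains E where "E \<in> sets M" "emeasure M (UNIV - E) = 0" "\<And>x. x \<in> E \<Longrightarrow> P x"
proof -
  obtain N where N: "\<And>x. x \<in> space M - N \<Longrightarrow> P x" "N \<in> null_sets M"
    using AE_E3[OF assms] by blast
  moreover have "UNIV - N \<in> sets M" using N(2) sets.compl_sets[of N M] by auto
  moreover have "UNIV - (UNIV - N) = N" by auto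
  ultimately show thesis using that[of "UNIV - N"] by auto
qed

lemma Inf_positive_full_sets_eq:
  fixes dim :: "cpt set \<Rightarrow> ereal"
  assumes nonzero: "0 < emeasure M UNIV"
    and lower: "\<And>E. E \<in> sets M \<Longrightarrow> 0 < emeasure M E \<Longrightarrow> d \<le> dim E"
    and upper: "AE x in M. P x" "\<And>E. (\<And>x. x \<in> E \<Longrightarrow> P x) \<Longrightarrow> dim E \<le> d"
  shows "Inf {dim E | E. E \<in> sets M \<and> emeasure M E > 0} = d" (is "?pos = d")
    and "Inf {dim E | E. E \<in> sets M \<and> emeasure M (UNIV - E) = 0} = d" (is "?full = d")
proof -
  have "d \<le> ?pos"
    by (rule Inf_greatest) (auto intro: lower)
  moreover have "0 < emeasure M E" if "E \<in> sets M" "emeasure M (UNIV - E) = 0" for E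
    using nonzero that emeasure_compl[OF that(1)] by (auto simp: zero_less_iff_neq_zero)
  then have "?pos \<le> ?full"
    by (intro Inf_superset_mono) auto
  moreover obtain E where "E \<in> sets M" "emeasure M (UNIV - E) = 0" "dim E \<le> d"
    using AE_obtain_full_set[OF upper(1)] upper(2) by metis
  then have "?full \<le> d"
    by (intro Inf_lower2[of "dim E"]) auto
  ultimately show "?pos = d" "?full = d" by auto
qed

theorem hausdorff_dimensions_eq_liminf:
  assumes "0 < emeasure M UNIV" "AE x in M. has_local_exponents h x" "\<And>n. 0 \<le> h n"
  shows "dim_lower M = liminf (\<lambda>n. ereal (h n))" "dim_upper M = liminf (\<lambda>n. ereal (h n))"
proof -
  have "0 \<le> liminf (\<lambda>n. ereal (h n))"
    using assms(3) by (intro Liminf_bounded) simp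
  note Inf_eq = Inf_positive_full_sets_eq[OF assms(1) liminf_le_hdim[OF assms(2)] assms(2) hdim_le_liminf[OF _ this]]
  show "dim_lower M = liminf (\<lambda>n. ereal (h n))" "dim_upper M = liminf (\<lambda>n. ereal (h n))"
    unfolding dim_lower_def dim_upper_def by (rule Inf_eq; assumption)+
qed

theorem packing_dimensions_eq_limsup:
  assumes "0 < emeasure M UNIV" "AE x in M. has_local_exponents h x" "\<And>n. 0 \<le> h n"
  shows "Dim_lower M = limsup (\<lambda>n. ereal (h n))" "Dim_upper M = limsup (\<lambda>n. ereal (h n))"
proof -
  have "0 \<le> limsup (\<lambda>n. ereal (h n))"
    using assms(3) by (intro le_Limsup) auto
  note Inf_eq = Inf_positive_full_sets_eq[OF assms(1) limsup_le_pdim[OF assms(2)] assms(2) pdim_le_limsup[OF _ this]]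
  show "Dim_lower M = limsup (\<lambda>n. ereal (h n))" "Dim_upper M = limsup (\<lambda>n. ereal (h n))"
    unfolding Dim_lower_def Dim_upper_def by (rule Inf_eq; assumption)+
qed

end

section \<open>Entropy estimates\<close>

lemma neg_ln_nonneg: "0 \<le> t \<Longrightarrow> t \<le> 1 \<Longrightarrow> 0 \<le> - ln (t::real)"
  by (cases "t = 0") auto

lemma mult_neg_ln_nonneg: "0 \<le> t \<Longrightarrow> t \<le> 1 \<Longrightarrow> 0 \<le> t * - ln (t::real)"
  by (intro mult_nonneg_nonneg neg_ln_nonneg)

lemma sqrt_mult_neg_ln_le:
  fixes t :: real
  assumes "0 \<le> t" "t \<le> 1"
  shows "sqrt t * - ln t \<le> 2 * (1 - sqrt t)"
proof (cases "t = 0")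
  case False
  then have t: "0 < t" using assms by simp
  have "ln (1 / sqrt t) \<le> 1 / sqrt t - 1"
    using t by (intro ln_le_minus_one) auto
  then have "- ln t \<le> 2 * (1 / sqrt t - 1)"
    using t by (simp add: ln_div ln_sqrt)
  then have "sqrt t * - ln t \<le> sqrt t * (2 * (1 / sqrt t - 1))"
    using t by (intro mult_left_mono) auto
  also have "\<dots> = 2 * (1 - sqrt t)" using t by (simp add: right_diff_distrib)
  finally show ?thesis .
qed simp

lemma mult_neg_ln_le:
  fixes t :: real
  assumes "0 \<le> t" "t \<le> 1"
  shows "t * - ln t \<le> 2 * (sqrt t * (1 - sqrt t))"
  using mult_left_mono[OF sqrt_mult_neg_ln_le[OF assms] real_sqrt_ge_zero[OF assms(1)]] assms(1)
  by (simp add: mult.left_commute flip: mult.assoc)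

lemma mult_neg_ln_le_half:
  fixes t :: real
  assumes "0 \<le> t" "t \<le> 1"
  shows "t * - ln t \<le> 1/2"
proof -
  have "0 \<le> (2 * sqrt t - 1)\<^sup>2" by simp
  also have "\<dots> = 1 - 4 * (sqrt t * (1 - sqrt t))"
    by (simp only: power2_eq_square) algebra
  finally have "sqrt t * (1 - sqrt t) \<le> 1/4" by simp
  with mult_neg_ln_le[OF assms] show ?thesis by simp
qed

lemma mult_neg_ln_le_sqrt:
  fixes t :: real
  assumes "0 \<le> t" "t \<le> 1"
  shows "t * - ln t \<le> 2 * sqrt t"
proof -
  have "sqrt t * (1 - sqrt t) \<le> sqrt t * 1"
    using assms by (intro mult_left_mono) auto
  with mult_neg_ln_le[OF assms] show ?thesis by simp
qed

lemma mult_neg_ln_le_sqrt_compl: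
  fixes t :: real
  assumes "0 \<le> t" "t \<le> 1"
  shows "t * - ln t \<le> 2 * sqrt (1 - t)"
proof -
  have "sqrt t * (1 - sqrt t) \<le> 1 * (1 - sqrt t)"
    using assms by (intro mult_right_mono) auto
  also have "\<dots> \<le> sqrt (1 - t)"
    using sqrt_add_le_add_sqrt[of t "1 - t"] assms by simp
  finally show ?thesis using mult_neg_ln_le[OF assms] by simp
qed

lemma mult_ln_squared_le:
  fixes t :: real
  assumes "0 \<le> t" "t \<le> 1"
  shows "t * (ln t)\<^sup>2 \<le> 4"
proof -
  have "0 \<le> sqrt t * - ln t"
    using assms by (intro mult_nonneg_nonneg neg_ln_nonneg) auto
  moreover have "sqrt t * - ln t \<le> 2"
    by (rule order_trans[OF sqrt_mult_neg_ln_le[OF assms]]) (use assms in simp)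
  ultimately have "(sqrt t * - ln t)\<^sup>2 \<le> 2\<^sup>2" by (intro power_mono)
  then show ?thesis using assms by (simp add: power_mult_distrib)
qed

lemma mult_neg_ln_diff_squared_le:
  fixes t c :: real
  assumes "0 \<le> t" "t \<le> 1" "0 \<le> c" "c \<le> 1"
  shows "t * (- ln t - c)\<^sup>2 \<le> 4 + t"
proof -
  have "t * (- ln t - c)\<^sup>2 = t * (ln t)\<^sup>2 - 2 * c * (t * - ln t) + t * c\<^sup>2"
    by (simp add: power2_eq_square algebra_simps)
  moreover have "0 \<le> 2 * c * (t * - ln t)"
    using assms by (intro mult_nonneg_nonneg mult_neg_ln_nonneg) auto
  moreover have "t * c\<^sup>2 \<le> t * 1"
    using assms by (intro mult_left_mono power_le_one)
  ultimately show ?thesis using mult_ln_squared_le[OF assms(1,2)] by linarith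
qed

definition binary_entropy :: "real \<Rightarrow> real" where
  "binary_entropy t = t * - ln t + (1 - t) * - ln (1 - t)"

lemma binary_entropy_compl: "binary_entropy (1 - t) = binary_entropy t"
  by (simp add: binary_entropy_def)

lemma binary_entropy_nonneg: "0 \<le> t \<Longrightarrow> t \<le> 1 \<Longrightarrow> 0 \<le> binary_entropy t"
  using mult_neg_ln_nonneg[of t] mult_neg_ln_nonneg[of "1 - t"] by (simp add: binary_entropy_def)

lemma binary_entropy_le_1: "0 \<le> t \<Longrightarrow> t \<le> 1 \<Longrightarrow> binary_entropy t \<le> 1"
  using mult_neg_ln_le_half[of t] mult_neg_ln_le_half[of "1 - t"] by (simp add: binary_entropy_def)

lemma binary_entropy_le_sqrt: "0 \<le> t \<Longrightarrow> t \<le> 1 \<Longrightarrow> binary_entropy t \<le> 4 * sqrt t"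
  using mult_neg_ln_le_sqrt[of t] mult_neg_ln_le_sqrt_compl[of "1 - t"] by (simp add: binary_entropy_def)

lemma binary_entropy_le_sqrt_distance:
  assumes "0 \<le> a" "a \<le> 1" "0 \<le> b" "b \<le> 1"
  shows "binary_entropy a \<le> 4 * sqrt (1 - \<bar>a - b\<bar>)"
proof (cases "a \<le> b")
  case True
  have "binary_entropy a \<le> 4 * sqrt a" using assms by (intro binary_entropy_le_sqrt)
  also have "sqrt a \<le> sqrt (1 - \<bar>a - b\<bar>)" using True assms by simp
  finally show ?thesis by simp
next
  case False
  have "binary_entropy a \<le> 4 * sqrt (1 - a)"
    using binary_entropy_le_sqrt[of "1 - a"] assms by (simp add: binary_entropy_compl)
  also have "sqrt (1 - a) \<le> sqrt (1 - \<bar>a - b\<bar>)" using False assms by simp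
  finally show ?thesis by simp
qed

lemma binary_entropy_diff_le:
  assumes "0 \<le> a" "a \<le> 1" "0 \<le> b" "b \<le> 1"
  shows "\<bar>binary_entropy a - binary_entropy b\<bar> \<le> 4 * sqrt (1 - \<bar>a - b\<bar>)"
  using binary_entropy_le_sqrt_distance[OF assms] binary_entropy_le_sqrt_distance[OF assms(3,4,1,2)]
    binary_entropy_nonneg[OF assms(1,2)] binary_entropy_nonneg[OF assms(3,4)]
  by (simp add: abs_minus_commute[of b a] abs_le_iff)

text \<open>Cauchy--Schwarz: the sum of \<open>a j * (1 - \<rho> j)\<close> telescopes to at most \<open>n\<close>, that of \<open>a j\<close> is at
  most \<open>n\<^sup>2\<close>.\<close>
lemma sum_contraction_sqrt_le:
  fixes a \<rho> :: "nat \<Rightarrow> real"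
  assumes a: "a 0 = 0" "\<And>j. 0 \<le> a j" "\<And>j. a (Suc j) \<le> \<rho> j * a j + 1" and \<rho>: "\<And>j. \<rho> j \<le> 1"
  shows "(\<Sum>j<n. a j * sqrt (1 - \<rho> j)) \<le> real n * sqrt (real n)"
proof -
  have a_le: "a j \<le> real j" for j
  proof (induction j)
    case (Suc j)
    have "\<rho> j * a j \<le> 1 * a j" using a(2) \<rho> by (intro mult_right_mono)
    with Suc a(3)[of j] show ?case by simp
  qed (simp add: a(1))
  have telescope: "(\<Sum>j<n. a j * (1 - \<rho> j)) \<le> real n - a n"
  proof (induction n)
    case (Suc n)
    with a(3)[of n] show ?case by (simp add: algebra_simps)
  qed (simp add: a(1))
  have "(\<Sum>j<n. a j * sqrt (1 - \<rho> j))\<^sup>2 = (\<Sum>j<n. sqrt (a j) * sqrt (a j * (1 - \<rho> j)))\<^sup>2"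
    using a(2) by (simp add: real_sqrt_mult flip: mult.assoc)
  also have "\<dots> \<le> (\<Sum>j<n. (sqrt (a j))\<^sup>2) * (\<Sum>j<n. (sqrt (a j * (1 - \<rho> j)))\<^sup>2)"
    by (rule Cauchy_Schwarz_ineq_sum)
  also have "\<dots> = (\<Sum>j<n. a j) * (\<Sum>j<n. a j * (1 - \<rho> j))"
    using a(2) \<rho> by simp
  also have "\<dots> \<le> (real n * real n) * real n"
  proof (rule mult_mono)
    have "(\<Sum>j<n. a j) \<le> (\<Sum>j<n. real n)"
      by (intro sum_mono order_trans[OF a_le]) simp
    then show "(\<Sum>j<n. a j) \<le> real n * real n" by simp
    show "(\<Sum>j<n. a j * (1 - \<rho> j)) \<le> real n" using telescope a(2)[of n] by linarith
    show "0 \<le> (\<Sum>j<n. a j * (1 - \<rho> j))" using a(2) \<rho> by (intro sum_nonneg) simp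
  qed simp
  also have "\<dots> = (real n * sqrt (real n))\<^sup>2" by (simp add: power2_eq_square)
  finally show ?thesis by (rule power2_le_imp_le) simp
qed

section \<open>Variance of the information function\<close>

locale markov_params =
  fixes p q :: "nat \<Rightarrow> real"
  assumes p_bounds: "0 \<le> p n" "p n \<le> 1" and q_bounds: "0 \<le> q n" "q n \<le> 1"
begin

definition prev_one :: "nat \<Rightarrow> cpt \<Rightarrow> bool" where
  "prev_one n x \<longleftrightarrow> 0 < n \<and> x (n - 1)"

definition zero_prob :: "nat \<Rightarrow> cpt \<Rightarrow> real" where
  "zero_prob n x = (if prev_one n x then q n else p n)"

definition weight :: "nat \<Rightarrow> cpt \<Rightarrow> real" where
  "weight n x = (\<Prod>i<n. mfactor p q x i)"

text \<open>A vanishing factor contributes \<open>ln 0 = 0\<close>; this happens only on a null set.\<close>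
definition info :: "nat \<Rightarrow> cpt \<Rightarrow> real" where
  "info n x = (\<Sum>i<n. - ln (mfactor p q x i))"

definition mean :: "nat \<Rightarrow> (cpt \<Rightarrow> real) \<Rightarrow> real" where
  "mean n F = (\<Sum>x\<in>words n. weight n x * F x)"

lemma mfactor_eq: "mfactor p q x n = (if x n then 1 - zero_prob n x else zero_prob n x)"
  by (auto simp: mfactor_def zero_prob_def prev_one_def)

lemma zero_prob_bounds: "0 \<le> zero_prob n x" "zero_prob n x \<le> 1"
  using p_bounds q_bounds by (auto simp: zero_prob_def)

lemma mfactor_bounds: "0 \<le> mfactor p q x n" "mfactor p q x n \<le> 1"
  using zero_prob_bounds[of n x] by (auto simp: mfactor_eq)

lemma mfactor_cong: "y \<in> cyl n x \<Longrightarrow> i < n \<Longrightarrow> mfactor p q y i = mfactor p q x i"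
  by (auto simp: mfactor_def cyl_def)

lemma cylindrical_weight: "cylindrical n (weight n)"
  unfolding weight_def by (intro cylindricalI prod.cong) (auto simp: mfactor_cong)

lemma cylindrical_info: "cylindrical n (info n)"
  unfolding info_def by (intro cylindricalI sum.cong) (auto simp: mfactor_cong)

lemma weight_nonneg: "0 \<le> weight n x"
  unfolding weight_def by (intro prod_nonneg) (use mfactor_bounds in auto)

lemma ln_weight:
  assumes "weight n x \<noteq> 0"
  shows "ln (weight n x) = - info n x"
proof -
  have "mfactor p q x i \<noteq> 0" if "i < n" for i
    using assms that by (auto simp: weight_def)
  then have "ln (weight n x) = (\<Sum>i<n. ln (mfactor p q x i))"
    unfolding weight_def using mfactor_bounds[of x] by (intro ln_prod) (auto simp: less_le)
  then show ?thesis by (simp add: info_def sum_negf)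
qed

lemma zero_prob_upd [simp]: "zero_prob n (x(n := b)) = zero_prob n x"
  by (cases n) (auto simp: zero_prob_def prev_one_def)

lemma info_0: "info 0 x = 0"
  by (simp add: info_def)

lemma info_Suc: "info (Suc n) x = info n x - ln (mfactor p q x n)"
  by (simp add: info_def)

lemma info_Suc_zero: "x \<in> words n \<Longrightarrow> info (Suc n) x = info n x - ln (zero_prob n x)"
  by (simp add: info_Suc mfactor_eq words_def)

lemma info_Suc_one: "info (Suc n) (x(n := True)) = info n x - ln (1 - zero_prob n x)"
  using cylindricalD[OF cylindrical_info upd_mem_cyl, of n x True] by (simp add: info_Suc mfactor_eq)

lemma info_mono: "mono (\<lambda>n. info n x)"
  by (intro mono_iff_le_Suc[THEN iffD2] allI) (use neg_ln_nonneg[OF mfactor_bounds] in \<open>simp add: info_Suc\<close>)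

lemma mean_0: "mean 0 F = F (\<lambda>_. False)"
  by (simp add: mean_def words_0 weight_def)

lemma mean_Suc:
  "mean (Suc n) F = mean n (\<lambda>x. zero_prob n x * F x + (1 - zero_prob n x) * F (x(n := True)))"
proof -
  have "weight (Suc n) x = weight n x * zero_prob n x" if "x \<in> words n" for x
    using that by (simp add: weight_def mfactor_eq words_def)
  moreover have "weight (Suc n) (x(n := True)) = weight n x * (1 - zero_prob n x)" for x
    using cylindricalD[OF cylindrical_weight upd_mem_cyl, of n x True]
    by (simp add: weight_def mfactor_eq)
  ultimately show ?thesis
    unfolding mean_def sum_words_Suc by (intro sum.cong) (simp_all add: distrib_left mult.assoc)
qed

lemma mean_cong: "(\<And>x. x \<in> words n \<Longrightarrow> F x = G x) \<Longrightarrow> mean n F = mean n G"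
  unfolding mean_def by (intro sum.cong) auto

lemma mean_mono: "(\<And>x. F x \<le> G x) \<Longrightarrow> mean n F \<le> mean n G"
  unfolding mean_def by (intro sum_mono mult_left_mono) (auto simp: weight_nonneg)

lemma mean_add: "mean n (\<lambda>x. F x + G x) = mean n F + mean n G"
  by (simp add: mean_def sum.distrib algebra_simps)

lemma mean_diff: "mean n (\<lambda>x. F x - G x) = mean n F - mean n G"
  by (simp add: mean_def sum_subtractf algebra_simps)

lemma mean_cmult: "mean n (\<lambda>x. c * F x) = c * mean n F"
  by (simp add: mean_def sum_distrib_left algebra_simps)

lemma mean_const: "mean n (\<lambda>x. c) = c"
proof (induction n)
  case (Suc n)
  have "mean (Suc n) (\<lambda>x. c) = mean n (\<lambda>x. c)"
    unfolding mean_Suc by (intro mean_cong) (simp add: algebra_simps)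
  with Suc show ?case by simp
qed (simp add: mean_0)

lemma mean_le: "(\<And>x. F x \<le> c) \<Longrightarrow> mean n F \<le> c"
  using mean_mono[of F "\<lambda>x. c" n] by (simp add: mean_const)

lemma mean_ge: "(\<And>x. c \<le> F x) \<Longrightarrow> c \<le> mean n F"
  using mean_mono[of "\<lambda>x. c" F n] by (simp add: mean_const)

definition mean_info :: "nat \<Rightarrow> real" where
  "mean_info n = mean n (info n)"

definition entropy_step :: "nat \<Rightarrow> real" where
  "entropy_step n = mean n (\<lambda>x. binary_entropy (zero_prob n x))"

lemma entropy_step_nonneg: "0 \<le> entropy_step n"
  unfolding entropy_step_def by (intro mean_ge binary_entropy_nonneg zero_prob_bounds)

lemma entropy_step_le_1: "entropy_step n \<le> 1"
  unfolding entropy_step_def by (intro mean_le binary_entropy_le_1 zero_prob_bounds)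

lemma mean_info_0: "mean_info 0 = 0"
  by (simp add: mean_info_def mean_0 info_0)

lemma mean_info_Suc: "mean_info (Suc n) = mean_info n + entropy_step n"
proof -
  have "mean_info (Suc n) = mean n (\<lambda>x. info n x + binary_entropy (zero_prob n x))"
    unfolding mean_info_def mean_Suc
    by (rule mean_cong) (simp add: info_Suc_zero info_Suc_one binary_entropy_def algebra_simps)
  then show ?thesis by (simp add: mean_add mean_info_def entropy_step_def)
qed

lemma mean_info_nonneg: "0 \<le> mean_info n"
  by (induction n) (use entropy_step_nonneg in \<open>simp_all add: mean_info_0 mean_info_Suc\<close>)

lemma mean_info_Suc_le: "mean_info (Suc n) \<le> mean_info n + 1"
  using entropy_step_le_1 by (simp add: mean_info_Suc)

definition fluct :: "nat \<Rightarrow> cpt \<Rightarrow> real" where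
  "fluct n x = info n x - mean_info n"

lemma fluct_0: "fluct 0 x = 0"
  by (simp add: fluct_def info_0 mean_info_0)

lemma fluct_Suc_zero:
  "x \<in> words n \<Longrightarrow> fluct (Suc n) x = fluct n x + (- ln (zero_prob n x) - entropy_step n)"
  by (simp add: fluct_def info_Suc_zero mean_info_Suc)

lemma fluct_Suc_one:
  "fluct (Suc n) (x(n := True)) = fluct n x + (- ln (1 - zero_prob n x) - entropy_step n)"
  by (simp add: fluct_def info_Suc_one mean_info_Suc)

text \<open>The part of the fluctuation carried by the event that the last letter is 0. The two states
  carry opposite fluctuations, so a Markov step contracts it by the factor \<open>\<bar>p n - q n\<bar>\<close>.\<close>
definition zero_fluct :: "nat \<Rightarrow> real" where
  "zero_fluct n = mean n (\<lambda>x. fluct n x * of_bool (\<not> prev_one n x))"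

definition variance :: "nat \<Rightarrow> real" where
  "variance n = mean n (\<lambda>x. (fluct n x)\<^sup>2)"

lemma mean_fluct: "mean n (fluct n) = 0"
  by (simp add: fluct_def[abs_def] mean_diff mean_const mean_info_def)

lemma mean_fluct_mult_state:
  "mean n (\<lambda>x. fluct n x * f (zero_prob n x)) = (f (p n) - f (q n)) * zero_fluct n"
proof -
  have "mean n (\<lambda>x. fluct n x * f (zero_prob n x)) =
    mean n (\<lambda>x. f (q n) * fluct n x + (f (p n) - f (q n)) * (fluct n x * of_bool (\<not> prev_one n x)))"
    by (rule mean_cong) (simp add: zero_prob_def algebra_simps)
  also have "\<dots> = (f (p n) - f (q n)) * zero_fluct n"
    by (simp only: mean_add mean_cmult mean_fluct zero_fluct_def mult_zero_right add_0)
  finally show ?thesis .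
qed

lemma zero_fluct_Suc_eq:
  "zero_fluct (Suc n) = (p n - q n) * zero_fluct n +
     mean n (\<lambda>x. zero_prob n x * (- ln (zero_prob n x) - entropy_step n))"
proof -
  have "zero_fluct (Suc n) = mean n (\<lambda>x. fluct n x * zero_prob n x +
      zero_prob n x * (- ln (zero_prob n x) - entropy_step n))"
    unfolding zero_fluct_def mean_Suc
  proof (rule mean_cong)
    fix x assume x: "x \<in> words n"
    then have "\<not> prev_one (Suc n) x" "prev_one (Suc n) (x(n := True))"
      by (auto simp: prev_one_def words_def)
    then show "zero_prob n x * (fluct (Suc n) x * of_bool (\<not> prev_one (Suc n) x)) +
       (1 - zero_prob n x) * (fluct (Suc n) (x(n := True)) * of_bool (\<not> prev_one (Suc n) (x(n := True)))) =
       fluct n x * zero_prob n x + zero_prob n x * (- ln (zero_prob n x) - entropy_step n)"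
      using x by (simp add: fluct_Suc_zero algebra_simps)
  qed
  then show ?thesis
    using mean_fluct_mult_state[of n "\<lambda>t. t"] by (simp add: mean_add)
qed

lemma zero_fluct_Suc_le: "\<bar>zero_fluct (Suc n)\<bar> \<le> \<bar>p n - q n\<bar> * \<bar>zero_fluct n\<bar> + 1"
proof -
  let ?F = "\<lambda>x. zero_prob n x * (- ln (zero_prob n x) - entropy_step n)"
  have F: "- 1 \<le> ?F x" "?F x \<le> 1" for x
  proof -
    let ?t = "zero_prob n x"
    have "0 \<le> ?t * entropy_step n" "?t * entropy_step n \<le> 1"
      using zero_prob_bounds[of n x] entropy_step_nonneg[of n] entropy_step_le_1[of n]
      by (auto intro: mult_le_one)
    moreover have "0 \<le> ?t * - ln ?t" "?t * - ln ?t \<le> 1/2"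
      using mult_neg_ln_nonneg mult_neg_ln_le_half zero_prob_bounds by blast+
    ultimately show "- 1 \<le> ?F x" "?F x \<le> 1"
      by (auto simp: right_diff_distrib)
  qed
  have "\<bar>mean n ?F\<bar> \<le> 1"
    using mean_ge[OF F(1), of n] mean_le[OF F(2), of n] by (simp add: abs_le_iff)
  then show ?thesis unfolding zero_fluct_Suc_eq abs_mult[symmetric] by linarith
qed

lemma variance_Suc_eq:
  "variance (Suc n) = variance n + 2 * ((binary_entropy (p n) - binary_entropy (q n)) * zero_fluct n) +
     mean n (\<lambda>x. zero_prob n x * (- ln (zero_prob n x) - entropy_step n)\<^sup>2 +
       (1 - zero_prob n x) * (- ln (1 - zero_prob n x) - entropy_step n)\<^sup>2)"
  (is "_ = _ + mean n ?step")
proof -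
  have "variance (Suc n) = mean n (\<lambda>x. (fluct n x)\<^sup>2 +
      2 * (fluct n x * (binary_entropy (zero_prob n x) - entropy_step n)) + ?step x)"
    unfolding variance_def mean_Suc
    by (rule mean_cong)
      (simp add: fluct_Suc_zero fluct_Suc_one binary_entropy_def power2_eq_square algebra_simps)
  then show ?thesis
    using mean_fluct_mult_state[of n "\<lambda>t. binary_entropy t - entropy_step n"]
    by (simp add: mean_add mean_cmult variance_def)
qed

lemma variance_Suc_le:
  "variance (Suc n) \<le> variance n + 8 * (\<bar>zero_fluct n\<bar> * sqrt (1 - \<bar>p n - q n\<bar>)) + 9"
proof -
  let ?step = "\<lambda>x. zero_prob n x * (- ln (zero_prob n x) - entropy_step n)\<^sup>2 +
    (1 - zero_prob n x) * (- ln (1 - zero_prob n x) - entropy_step n)\<^sup>2"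
  have "mean n ?step \<le> 9"
  proof (rule mean_le)
    fix x
    note bounds = mult_neg_ln_diff_squared_le[OF _ _ entropy_step_nonneg entropy_step_le_1]
    show "?step x \<le> 9"
      using bounds[of "zero_prob n x" n] bounds[of "1 - zero_prob n x" n] zero_prob_bounds[of n x] by simp
  qed
  moreover have "(binary_entropy (p n) - binary_entropy (q n)) * zero_fluct n
      \<le> \<bar>binary_entropy (p n) - binary_entropy (q n)\<bar> * \<bar>zero_fluct n\<bar>"
    by (metis abs_ge_self abs_mult)
  moreover have "\<dots> \<le> 4 * sqrt (1 - \<bar>p n - q n\<bar>) * \<bar>zero_fluct n\<bar>"
    using p_bounds q_bounds by (intro mult_right_mono binary_entropy_diff_le) auto
  ultimately show ?thesis unfolding variance_Suc_eq by (simp add: algebra_simps)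
qed

lemma variance_le: "variance n \<le> 17 * (real n * sqrt (real n))"
proof -
  let ?a = "\<lambda>j. \<bar>zero_fluct j\<bar>" and ?\<rho> = "\<lambda>j. \<bar>p j - q j\<bar>"
  have "variance n \<le> 9 * real n + 8 * (\<Sum>j<n. ?a j * sqrt (1 - ?\<rho> j))"
  proof (induction n)
    case 0
    show ?case by (simp add: variance_def mean_0 fluct_0)
  next
    case (Suc n)
    with variance_Suc_le[of n] show ?case by (simp add: algebra_simps)
  qed
  moreover have "(\<Sum>j<n. ?a j * sqrt (1 - ?\<rho> j)) \<le> real n * sqrt (real n)"
  proof (rule sum_contraction_sqrt_le)
    show "?a 0 = 0" by (simp add: zero_fluct_def mean_0 fluct_0)
    show "?\<rho> j \<le> 1" for j using p_bounds[of j] q_bounds[of j] by auto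
    show "?a (Suc j) \<le> ?\<rho> j * ?a j + 1" for j by (rule zero_fluct_Suc_le)
  qed simp
  moreover have "real n * 1 \<le> real n * sqrt (real n)"
    by (cases n) (auto intro: mult_left_mono)
  ultimately show ?thesis by simp
qed

end

section \<open>Law of large numbers and the main theorem\<close>

lemma strict_mono_nat_bracket:
  fixes f :: "nat \<Rightarrow> nat"
  assumes "strict_mono f" "f K \<le> n"
  obtains k where "K \<le> k" "f k \<le> n" "n < f (Suc k)"
proof -
  define m where "m = (LEAST j. n < f j)"
  have "n < f (Suc n)" using seq_suble[OF assms(1), of "Suc n"] by simp
  then have m: "n < f m" unfolding m_def by (rule LeastI)
  with assms have "K < m" by (meson le_less_trans strict_mono_less)
  then obtain k where k: "m = Suc k" "K \<le> k" by (metis less_imp_Suc_add le_add1)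
  have "\<not> n < f k" using not_less_Least[of k "\<lambda>j. n < f j"] k(1) by (simp add: m_def)
  with k m show thesis using that by simp
qed

lemma tendsto_0_if_bracket_bound:
  fixes X g :: "nat \<Rightarrow> real" and f :: "nat \<Rightarrow> nat"
  assumes f: "strict_mono f" and g: "g \<longlonglongrightarrow> 0"
    and bound: "\<And>k n. 1 \<le> k \<Longrightarrow> f k \<le> n \<Longrightarrow> n < f (Suc k) \<Longrightarrow> \<bar>X n\<bar> \<le> g k"
  shows "X \<longlonglongrightarrow> 0"
proof (rule LIMSEQ_I)
  fix \<epsilon> :: real assume "0 < \<epsilon>"
  then obtain K where K: "\<And>k. K \<le> k \<Longrightarrow> g k < \<epsilon>"
    using order_tendstoD(2)[OF g] by (auto simp: eventually_sequentially)
  have "norm (X n - 0) < \<epsilon>" if n: "f (max 1 K) \<le> n" for n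
  proof -
    obtain k where "max 1 K \<le> k" "f k \<le> n" "n < f (Suc k)"
      using strict_mono_nat_bracket[OF f n] .
    then show ?thesis using bound[of k n] K[of k] by simp
  qed
  then show "\<exists>N. \<forall>n\<ge>N. norm (X n - 0) < \<epsilon>" by blast
qed

lemma abs_diff_le_bracket:
  fixes S e :: "nat \<Rightarrow> real"
  assumes S: "mono S" and e: "\<And>n. e (Suc n) \<le> e n + C" and n: "l \<le> n" "n \<le> u"
  shows "\<bar>S n - e n\<bar> \<le> \<bar>S l - e l\<bar> + \<bar>S u - e u\<bar> + \<bar>C\<bar> * (real u - real l)"
proof -
  have e_le: "e j \<le> e i + \<bar>C\<bar> * (real u - real l)" if "l \<le> i" "i \<le> j" "j \<le> u" for i j
  proof -
    have "e j \<le> e i + \<bar>C\<bar> * (real j - real i)"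
      using \<open>i \<le> j\<close>
    proof (induction rule: dec_induct)
      case (step k)
      then show ?case using e[of k] by (simp add: algebra_simps)
    qed simp
    also have "\<bar>C\<bar> * (real j - real i) \<le> \<bar>C\<bar> * (real u - real l)"
      using that by (intro mult_left_mono) auto
    finally show ?thesis by simp
  qed
  have "S l \<le> S n" "S n \<le> S u"
    using n by (auto intro: monoD[OF S])
  with e_le[of l n] e_le[of n u] n show ?thesis by linarith
qed

lemma tendsto_interpolate_subsequence:
  fixes S e :: "nat \<Rightarrow> real" and f :: "nat \<Rightarrow> nat"
  assumes S: "mono S" and e: "\<And>n. e (Suc n) \<le> e n + C"
    and f: "strict_mono f" "(\<lambda>k. real (f (Suc k)) / real (f k)) \<longlonglongrightarrow> 1"
    and lim: "(\<lambda>k. (S (f k) - e (f k)) / real (f k)) \<longlonglongrightarrow> 0"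
  shows "(\<lambda>n. (S n - e n) / real n) \<longlonglongrightarrow> 0"
proof -
  define d where "d k = \<bar>S (f k) - e (f k)\<bar>" for k
  define D where "D k = d k / real (f k)" for k
  define R where "R k = real (f (Suc k)) / real (f k)" for k
  define g where "g k = D k + D (Suc k) * R k + \<bar>C\<bar> * (R k - 1)" for k
  have D: "D \<longlonglongrightarrow> 0"
    using tendsto_rabs_zero[OF lim] by (simp add: D_def[abs_def] d_def abs_divide)
  have "g \<longlonglongrightarrow> 0 + 0 * 1 + \<bar>C\<bar> * (1 - 1)"
    unfolding g_def R_def by (intro tendsto_intros D f(2) LIMSEQ_Suc[OF D])
  then have g: "g \<longlonglongrightarrow> 0" by simp
  have bound: "\<bar>(S n - e n) / real n\<bar> \<le> g k" if k: "1 \<le> k" "f k \<le> n" "n < f (Suc k)" for n k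
  proof -
    have fk: "0 < f k" using k(1) seq_suble[OF f(1), of k] by simp
    then have "\<bar>(S n - e n) / real n\<bar> \<le> \<bar>S n - e n\<bar> / real (f k)"
      using k(2) unfolding abs_divide abs_of_nat by (intro divide_left_mono) auto
    also have "\<dots> \<le> (d k + d (Suc k) + \<bar>C\<bar> * (real (f (Suc k)) - real (f k))) / real (f k)"
      unfolding d_def using k S e by (intro divide_right_mono abs_diff_le_bracket) auto
    also have "\<dots> = g k"
      using fk k by (simp add: g_def D_def R_def add_divide_distrib right_diff_distrib diff_divide_distrib)
    finally show ?thesis .
  qed
  show ?thesis
    using f(1) g by (rule tendsto_0_if_bracket_bound) (use bound in simp)
qed

lemma AE_tendsto_0_if_summable_nn_integral:
  fixes Z :: "nat \<Rightarrow> 'a \<Rightarrow> real"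
  assumes Z [measurable]: "\<And>k. Z k \<in> borel_measurable M" and nonneg: "\<And>k x. 0 \<le> Z k x"
    and le: "\<And>k. (\<integral>\<^sup>+x. ennreal (Z k x) \<partial>M) \<le> ennreal (c k)" and c: "summable c" "\<And>k. 0 \<le> c k"
  shows "AE x in M. (\<lambda>k. Z k x) \<longlonglongrightarrow> 0"
proof -
  have "(\<integral>\<^sup>+x. (\<Sum>k. ennreal (Z k x)) \<partial>M) = (\<Sum>k. \<integral>\<^sup>+x. ennreal (Z k x) \<partial>M)"
    by (rule nn_integral_suminf) measurable
  also have "\<dots> \<le> (\<Sum>k. ennreal (c k))"
    by (intro suminf_le le) auto
  also have "\<dots> < \<infinity>"
    using ennreal_suminf_neq_top[OF c] by (simp add: less_top)
  finally have "AE x in M. (\<Sum>k. ennreal (Z k x)) \<noteq> \<infinity>"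
    by (intro nn_integral_PInf_AE) auto
  then show ?thesis
  proof eventually_elim
    case (elim x)
    then have "summable (\<lambda>k. Z k x)"
      using nonneg by (intro summable_suminf_not_top) auto
    then show ?case by (rule summable_LIMSEQ_zero)
  qed
qed

lemma (in cantor_measure) nn_integral_cylindrical:
  assumes "cylindrical n F"
  shows "(\<integral>\<^sup>+x. F x \<partial>M) = (\<Sum>y\<in>words n. F y * emeasure M (cyl n y))"
proof -
  have "F x = (\<Sum>y\<in>words n. F y * indicator (cyl n y) x)" for x
  proof -
    have "(\<Sum>y\<in>words n. F y * indicator (cyl n y) x) = (\<Sum>y\<in>words n. if trunc n x = y then F y else 0)"
      by (intro sum.cong) (auto simp: mem_cyl_word_iff)
    also have "\<dots> = F (trunc n x)"
      by (simp add: sum.delta finite_words trunc_mem_words)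
    also have "\<dots> = F x"
      using assms trunc_mem_cyl by (rule cylindricalD)
    finally show ?thesis by simp
  qed
  then have "(\<integral>\<^sup>+x. F x \<partial>M) = (\<integral>\<^sup>+x. (\<Sum>y\<in>words n. F y * indicator (cyl n y) x) \<partial>M)"
    by (rule nn_integral_cong)
  also have "\<dots> = (\<Sum>y\<in>words n. F y * emeasure M (cyl n y))"
    by (subst nn_integral_sum) (auto simp: nn_integral_cmult_indicator)
  finally show ?thesis .
qed

locale markov_measure = markov_params + cantor_measure +
  assumes emeasure_cyl: "emeasure M (cyl n x) = ennreal (\<Prod>i<n. mfactor p q x i)"
begin

lemma measure_cyl: "measure M (cyl n x) = weight n x"
  using emeasure_cyl[of n x] weight_nonneg[of n x] by (simp add: measure_def weight_def)

lemma nn_integral_eq_mean: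
  assumes "cylindrical n F" "\<And>x. 0 \<le> F x"
  shows "(\<integral>\<^sup>+x. ennreal (F x) \<partial>M) = ennreal (mean n F)"
proof -
  have "(\<integral>\<^sup>+x. ennreal (F x) \<partial>M) = (\<Sum>y\<in>words n. ennreal (F y) * emeasure M (cyl n y))"
    using assms(1) by (intro nn_integral_cylindrical) (auto simp: cylindrical_def)
  also have "\<dots> = (\<Sum>y\<in>words n. ennreal (weight n y * F y))"
    using assms(2) by (simp add: emeasure_eq_measure measure_cyl ennreal_mult weight_nonneg mult.commute)
  also have "\<dots> = ennreal (mean n F)"
    unfolding mean_def using assms(2) by (intro sum_ennreal) (simp add: weight_nonneg)
  finally show ?thesis .
qed

lemma AE_fluct_fourth_powers_tendsto: "AE x in M. (\<lambda>k. fluct (k ^ 4) x / real (k ^ 4)) \<longlonglongrightarrow> 0"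
proof -
  define Z where "Z k x = (fluct (k ^ 4) x / real (k ^ 4))\<^sup>2" for k x
  have Z: "cylindrical (k ^ 4) (Z k)" for k
    using cylindricalD[OF cylindrical_info] by (intro cylindricalI) (simp add: Z_def fluct_def)
  have "AE x in M. (\<lambda>k. Z k x) \<longlonglongrightarrow> 0"
  proof (rule AE_tendsto_0_if_summable_nn_integral)
    show "Z k \<in> borel_measurable M" for k
      using Z by (rule cylindrical_measurable) simp
    show "(\<integral>\<^sup>+x. ennreal (Z k x) \<partial>M) \<le> ennreal (17 * (1 / real k ^ 2))" for k
    proof -
      have "(\<integral>\<^sup>+x. ennreal (Z k x) \<partial>M) = ennreal (mean (k ^ 4) (Z k))"
        using Z by (rule nn_integral_eq_mean) (simp add: Z_def)
      also have "mean (k ^ 4) (Z k) = variance (k ^ 4) / (real (k ^ 4))\<^sup>2"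
        using mean_cmult[of "k ^ 4" "1 / (real (k ^ 4))\<^sup>2" "\<lambda>x. (fluct (k ^ 4) x)\<^sup>2"]
        by (simp add: Z_def[abs_def] variance_def power_divide)
      also have "\<dots> \<le> 17 * (real (k ^ 4) * sqrt (real (k ^ 4))) / (real (k ^ 4))\<^sup>2"
        by (intro divide_right_mono variance_le) simp
      also have "sqrt (real (k ^ 4)) = real k ^ 2"
        by (rule real_sqrt_unique) (simp_all flip: power_mult)
      also have "17 * (real (k ^ 4) * real k ^ 2) / (real (k ^ 4))\<^sup>2 = 17 * (1 / real k ^ 2)"
        by (cases "k = 0") (auto simp: field_simps simp flip: power_add power_mult)
      finally show ?thesis by (auto intro: ennreal_leI)
    qed
    show "summable (\<lambda>k. 17 * (1 / real k ^ 2))"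
      using inverse_power_summable[of 2, where 'a = real]
      by (intro summable_mult) (simp add: inverse_eq_divide)
  qed (simp_all add: Z_def)
  then show ?thesis
  proof eventually_elim
    case (elim x)
    then have "(\<lambda>k. sqrt (Z k x)) \<longlonglongrightarrow> sqrt 0" by (rule tendsto_real_sqrt)
    then show ?case
      unfolding Z_def real_sqrt_abs real_sqrt_zero by (rule tendsto_rabs_zero_cancel)
  qed
qed

lemma AE_fluct_tendsto: "AE x in M. (\<lambda>n. fluct n x / real n) \<longlonglongrightarrow> 0"
  using AE_fluct_fourth_powers_tendsto
proof eventually_elim
  case (elim x)
  show ?case
    unfolding fluct_def
  proof (rule tendsto_interpolate_subsequence)
    show "strict_mono (\<lambda>k::nat. k ^ 4)" by (intro strict_monoI power_strict_mono) auto
    show "(\<lambda>k. real (Suc k ^ 4) / real (k ^ 4)) \<longlonglongrightarrow> 1" by real_asymp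
  qed (use elim in \<open>auto simp: fluct_def intro: info_mono mean_info_Suc_le\<close>)
qed

lemma entropy_n_eq: "entropy_n M n = mean_info n"
proof -
  have "entropy_n M n = - (\<Sum>x\<in>words n. xlogx (weight n x))"
    unfolding entropy_n_def gen_eq_cyl_words by (simp add: sum.reindex inj_on_cyl_words measure_cyl)
  also have "\<dots> = (\<Sum>x\<in>words n. weight n x * info n x)"
    unfolding sum_negf[symmetric] by (intro sum.cong) (auto simp: xlogx_def ln_weight)
  finally show ?thesis by (simp add: mean_info_def mean_def)
qed

lemma AE_has_local_exponents: "AE x in M. has_local_exponents (\<lambda>n. entropy_n M n / (real n * ln 2)) x"
  using AE_fluct_tendsto AE_measure_cyl_pos
proof eventually_elim
  case (elim x)
  have measure_eq: "measure M (cyl n x) = exp (- info n x)" for n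
    using elim(2) ln_weight[of n x] by (metis exp_ln less_irrefl measure_cyl)
  show ?case
    unfolding has_local_exponents_def
  proof (intro allI impI)
    fix \<epsilon> :: real assume "0 < \<epsilon>"
    then have "\<forall>\<^sub>F n in sequentially. dist (fluct n x / real n) 0 < \<epsilon> * ln 2"
      using elim(1) by (intro tendstoD) auto
    then show "\<forall>\<^sub>F n in sequentially. heavy (entropy_n M n / (real n * ln 2) + \<epsilon>) n x \<and>
        light (entropy_n M n / (real n * ln 2) - \<epsilon>) n x"
      using eventually_gt_at_top[of 0]
    proof eventually_elim
      case (elim n)
      then have "\<bar>fluct n x\<bar> \<le> \<epsilon> * ln 2 * real n"
        by (simp add: abs_divide pos_divide_less_eq)
      with elim(2) show ?case
        by (simp add: heavy_def light_def measure_eq entropy_n_eq fluct_def powr_def algebra_simps abs_le_iff)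
    qed
  qed
qed

end

theorem theorem1:
  fixes p q :: "nat \<Rightarrow> real" and \<mu> :: "cpt measure"
  assumes "\<And>n. 0 \<le> p n \<and> p n \<le> 1"
    and "\<And>n. 0 \<le> q n \<and> q n \<le> 1"
    and "space \<mu> = UNIV"
    and "sets \<mu> = sigma_sets UNIV (\<Union>n. gen n)"
    and "\<And>n x. emeasure \<mu> (cyl n x) = ennreal (\<Prod>i<n. mfactor p q x i)"
  shows "dim_lower \<mu> = dim_upper \<mu> \<and> dim_upper \<mu> = h_lower \<mu> \<and>
         Dim_lower \<mu> = Dim_upper \<mu> \<and> Dim_upper \<mu> = h_upper \<mu>"
proof -
  have total_mass: "emeasure \<mu> UNIV = 1" using assms(5)[of 0] by simp
  interpret finite_measure \<mu>
    by (rule finite_measureI) (simp add: assms(3) total_mass)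
  interpret markov_measure p q \<mu>
  proof
    show "cyl n x \<in> sets \<mu>" for n x
      unfolding assms(4) using cyl_mem_gen by (intro sigma_sets.Basic) blast
    show "0 \<le> p n" "p n \<le> 1" "0 \<le> q n" "q n \<le> 1" for n
      using assms(1,2)[of n] by simp_all
  qed (fact assms(3,5))+
  have "0 < emeasure \<mu> UNIV" by (simp add: total_mass)
  moreover have "0 \<le> entropy_n \<mu> n / (real n * ln 2)" for n
    using mean_info_nonneg by (simp add: entropy_n_eq)
  ultimately show ?thesis
    unfolding h_lower_def h_upper_def
    using hausdorff_dimensions_eq_liminf[OF _ AE_has_local_exponents]
      packing_dimensions_eq_limsup[OF _ AE_has_local_exponents] by simp
qed

end
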